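(* Let $Q$ be a positive random variable with $E(Q)=1$ but with otherwise arbitrary distribution. Consider the homogeneous continuous-time branching process with unknown birth rate $\delta$ and life-length distribution $Q$, started from $X(0)=1$, where $X(u)$ is the number of individuals alive at time $u$. Let $A_K=\int_0^\infty 1_{\{X(u)=K\}}\,du$ and $T=\sum_{K=1}^\infty A_K$. (i) Let $K\ge 2$ and suppose that $A_K=t_K$ is observed. If the process is known to be subcritical ($\delta<1$), then the moment estimator of $\delta$ is $\hat\delta=(Kt_K)^{1/(K-1)}$. (ii) Let $K\ge 2$ and suppose that $A_K=t_K$ is observed. If the process is known to be supercritical ($\delta>1$), then the moment estimator of $\delta$ is $\hat\delta=1/(Kt_K)$. (iii) If instead $T=t$ is observed and the process is known to be subcritical ($\delta<1$), then the moment estimator $\hat\delta$ of $\delta$ is the largest solution of $1-\delta=e^{-\delta t}$.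
   Context: The branching process (a binary splitting tree) is defined as follows. At time $0$ there is one newborn ancestor. Every individual lives for a random time distributed as $Q$; during its life it gives birth to single children at the points of a Poisson process of constant rate $\delta\ge 0$. All life-lengths and all birth Poisson processes are mutually independent, and each child from its birth behaves in the same way. $T$ is the total time until extinction. Moment estimator: given an observed value $s$ of a statistic $S$ (here $S=A_K$ or $S=T$) and the assumed parameter range ($[0,1)$ in the subcritical case, $(1,\infty)$ in the supercritical case), the moment estimator $\hat\delta$ is the value of $\delta$ in the range for which the expectation $E_\delta(S)$, computed under birth rate $\delta$, equals $s$ (when such a value exists). *)

theory Defs
  imports "HOL-Probability.Probability" "HOL-Library.Extended_Nat"
begin

text \<open>
  Individuals carry Ulam--Harris labels: \<open>[]\<close> is the ancestor, and \<open>i # u\<close> is the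
  child produced at the \<open>i\<close>-th point (counting from 0) of the birth process of \<open>u\<close>.
\<close>

type_synonym individual = "nat list"

text \<open>
  Law of the waiting time between consecutive points of a Poisson process of rate \<open>\<delta>\<close>.
  For \<open>\<delta> = 0\<close> the process has no points, i.e. the waiting time is infinite.
\<close>

definition waiting_time_law :: "real \<Rightarrow> ennreal measure" where
  "waiting_time_law \<delta> =
     (if \<delta> = 0 then return borel \<infinity>
      else distr (density lborel (\<lambda>x. ennreal (exponential_density \<delta> x))) borel ennreal)"

definition (in prob_space) poisson_waiting_times :: "real \<Rightarrow> (nat \<Rightarrow> 'a \<Rightarrow> ennreal) \<Rightarrow> bool" where
  "poisson_waiting_times \<delta> W \<longleftrightarrow>
     indep_vars (\<lambda>_. borel) W UNIV \<and> (\<forall>i. distr M borel (W i) = waiting_time_law \<delta>)"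

text \<open>
  \<open>life u\<close> is the life-length of \<open>u\<close>, and \<open>wait u\<close> are the waiting times of the Poisson
  process of \<open>u\<close>, which runs in the age of \<open>u\<close> and is cut off only at the death of \<open>u\<close>
  (see \<open>born\<close> below).  The last two assumptions together say that all life-lengths and all
  Poisson processes are mutually independent; \<open>indep_life_wait\<close> is spelled out because
  \<open>indep_var\<close> requires both variables to have the same type.  Individuals that are never born carry
  variables too, but these do not influence the population.
\<close>

locale splitting_tree = prob_space M
  for M :: "'w measure" +
  fixes \<delta> :: real
    and life_law :: "real measure"
    and life :: "individual \<Rightarrow> 'w \<Rightarrow> real"
    and wait :: "individual \<Rightarrow> nat \<Rightarrow> 'w \<Rightarrow> ennreal"
  assumes life_distr: "\<And>u. distr M borel (life u) = life_law"
    and wait_poisson: "\<And>u. poisson_waiting_times \<delta> (wait u)"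
    and indep_life_wait:
      "\<And>u. distr M (borel \<Otimes>\<^sub>M PiM UNIV (\<lambda>_. borel)) (\<lambda>\<omega>. (life u \<omega>, \<lambda>i. wait u i \<omega>)) =
             distr M borel (life u) \<Otimes>\<^sub>M distr M (PiM UNIV (\<lambda>_. borel)) (\<lambda>\<omega> i. wait u i \<omega>)"
    and indep_individuals:
      "indep_vars (\<lambda>_. borel \<Otimes>\<^sub>M PiM UNIV (\<lambda>_. borel))
         (\<lambda>u \<omega>. (life u \<omega>, \<lambda>i. wait u i \<omega>)) UNIV"

text \<open>
  The following functionals are defined for one realisation: \<open>l u\<close> and \<open>w u i\<close> are the
  realised life-lengths and waiting times.
\<close>

definition birth_age :: "(nat \<Rightarrow> ennreal) \<Rightarrow> nat \<Rightarrow> ennreal" where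
  "birth_age v i = (\<Sum>j\<le>i. v j)"

primrec birth_time :: "(individual \<Rightarrow> nat \<Rightarrow> ennreal) \<Rightarrow> individual \<Rightarrow> ennreal" where
  "birth_time w [] = 0"
| "birth_time w (i # u) = birth_time w u + birth_age (w u) i"

primrec born :: "(individual \<Rightarrow> real) \<Rightarrow> (individual \<Rightarrow> nat \<Rightarrow> ennreal) \<Rightarrow> individual \<Rightarrow> bool" where
  "born l w [] = True"
| "born l w (i # u) = (born l w u \<and> birth_age (w u) i < ennreal (l u))"

definition alive ::
  "(individual \<Rightarrow> real) \<Rightarrow> (individual \<Rightarrow> nat \<Rightarrow> ennreal) \<Rightarrow> real \<Rightarrow> individual set" where
  "alive l w t = {u. born l w u \<and> birth_time w u \<le> ennreal t
                       \<and> ennreal t < birth_time w u + ennreal (l u)}"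

definition population ::
  "(individual \<Rightarrow> real) \<Rightarrow> (individual \<Rightarrow> nat \<Rightarrow> ennreal) \<Rightarrow> real \<Rightarrow> enat" where
  "population l w t = (if finite (alive l w t) then enat (card (alive l w t)) else \<infinity>)"

definition time_at ::
  "(individual \<Rightarrow> real) \<Rightarrow> (individual \<Rightarrow> nat \<Rightarrow> ennreal) \<Rightarrow> nat \<Rightarrow> ennreal" where
  "time_at l w K = (\<integral>\<^sup>+ t \<in> {0..}. indicator {t. population l w t = enat K} t \<partial>lborel)"

definition extinction_time ::
  "(individual \<Rightarrow> real) \<Rightarrow> (individual \<Rightarrow> nat \<Rightarrow> ennreal) \<Rightarrow> ennreal" where
  "extinction_time l w = (\<Sum>K. time_at l w (Suc K))"

text \<open>
  \<open>E \<delta>\<close> is the expectation of the statistic under the parameter \<open>\<delta>\<close>, \<open>R\<close> the parameter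
  range, \<open>s\<close> the (nonnegative) observed value.  No \<open>d\<close> satisfies the predicate when the
  moment equation has no solution in \<open>R\<close>.
\<close>

definition moment_estimator :: "(real \<Rightarrow> ennreal) \<Rightarrow> real set \<Rightarrow> real \<Rightarrow> real \<Rightarrow> bool" where
  "moment_estimator E R s d \<longleftrightarrow>
     d \<in> R \<and> E d = ennreal s \<and> (\<forall>d'\<in>R. E d' = ennreal s \<longrightarrow> d' = d)"

definition largest_solution :: "(real \<Rightarrow> bool) \<Rightarrow> real \<Rightarrow> bool" where
  "largest_solution P d \<longleftrightarrow> P d \<and> (\<forall>d'. P d' \<longrightarrow> d' \<le> d)"

end

theory Submission
  imports Defs
begin

text \<open>
  Let \<open>m t\<close> (below: \<open>life_tail t\<close>) be the probability that a life is longer than \<open>t\<close>, \<open>G s t\<close> the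
  expectation of \<open>s\<close> to the power \<open>X(t)\<close>, and \<open>F s t\<close> the integral of \<open>1 - G s\<close> over \<open>[0, t]\<close>.  Restarting the process at the first
  birth shows that, for an ancestor of fixed life \<open>r\<close>, the generating function of \<open>X(t)\<close> is
  \<open>exp (- \<delta> * (F s t - F s (t - min r t)))\<close>, times \<open>s\<close> if \<open>t < r\<close>.  Averaging over \<open>r\<close> gives a linear
  equation for \<open>V s = exp (\<delta> * F s)\<close>: with \<open>*\<close> for the convolution on \<open>[0, t]\<close>,
  \<open>V s = 1 - \<delta> * s * (1 * m) + \<delta> * (V s * m)\<close>.  Hence \<open>V s = s + (1 - s) * W\<close>, where
  \<open>W = 1 + \<delta> * (W * m)\<close> does not involve \<open>s\<close>, and \<open>\<delta> * F s = ln (s + (1 - s) * W)\<close>.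
  Comparing the coefficients of powers of \<open>s\<close>, the expected time spent in state \<open>K\<close> before \<open>t\<close> is
  \<open>(1 - 1 / W t) ^ K / (\<delta> * K)\<close>.  Since the integral of \<open>m\<close> is 1, \<open>1 - 1 / W t\<close> tends to \<open>min 1 \<delta>\<close>
  whatever the law of the life-length.
\<close>

section \<open>Volterra equations and power series\<close>

text \<open>For a general life-length \<open>X\<close> is not a Markov process, and conditioning on
  the death of the ancestor would leave a whole random set of children to handle at once. Cutting at
  the first birth leaves two independent trees, one of them with an old ancestor; hence the
  generating function has to carry the remaining life \<open>r\<close>. Since \<open>r\<close> and
  \<open>t\<close> shrink by the same amount, the recursion stays on one diagonal and is a
  one-variable equation. The average over \<open>r\<close> looks nonlinear, because \<open>F\<close>
  sits in an exponent; multiplying by \<open>V s t\<close> turns the exponential of a difference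
  into \<open>V s (t - r)\<close>, and linearity comes from there. The tail \<open>m\<close> may
  jump and \<open>G s\<close> is only known to be measurable, so nothing is differentiated: all
  differential equations appear in integrated form, with uniqueness from an iterated Gronwall bound.
  The kernel \<open>\<delta> * m\<close> has total mass \<open>\<delta>\<close>, so a finite limit
  of \<open>W\<close> must be \<open>1 / (1 - \<delta>)\<close>, and otherwise \<open>W\<close> is
  unbounded. Taking \<open>s\<close> strictly between 0 and 1 lets an infinite population count as
  0, so explosion needs no separate treatment.\<close>

lemma bounded_borel_integrable_on:
  fixes f :: "real \<Rightarrow> real"
  assumes [measurable]: "f \<in> borel_measurable borel" and B: "\<And>x. x \<in> {a..b} \<Longrightarrow> \<bar>f x\<bar> \<le> B"
  shows "f integrable_on {a..b}"
proof -
  have "integrable lborel (\<lambda>x. indicator {a..b} x *\<^sub>R f x)"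
  proof (rule Bochner_Integration.integrable_bound)
    show "integrable lborel (\<lambda>x. indicator {a..b} x *\<^sub>R B)"
      by (intro integrable_scaleR_left integrable_real_indicator) (auto simp: emeasure_lborel_Icc_eq)
    show "AE x in lborel. norm (indicator {a..b} x *\<^sub>R f x) \<le> norm (indicator {a..b} x *\<^sub>R B)"
      using B by (intro AE_I2) (force simp: indicator_def)
  qed simp
  then have "set_integrable lborel {a..b} f"
    by (simp add: set_integrable_def)
  then show ?thesis
    by (rule set_borel_integral_eq_integral)
qed

lemma nn_integral_Icc_eq_integral:
  fixes f :: "real \<Rightarrow> real"
  assumes [measurable]: "f \<in> borel_measurable borel"
    and B: "\<And>x. x \<in> {a..b} \<Longrightarrow> 0 \<le> f x" "\<And>x. x \<in> {a..b} \<Longrightarrow> f x \<le> B"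
  shows "(\<integral>\<^sup>+x\<in>{a..b}. ennreal (f x) \<partial>lborel) = ennreal (integral {a..b} f)"
proof (rule set_nn_integral_lborel_eq_integral)
  show "set_borel_measurable borel {a..b} f"
    by (simp add: set_borel_measurable_def)
  have "(\<integral>\<^sup>+x\<in>{a..b}. ennreal (f x) \<partial>lborel) \<le> (\<integral>\<^sup>+x. ennreal B * indicator {a..b} x \<partial>lborel)"
    using B by (intro nn_integral_mono) (auto simp: indicator_def intro: ennreal_leI)
  also have "\<dots> < \<infinity>"
    by (simp add: nn_integral_cmult_indicator emeasure_lborel_Icc_eq ennreal_mult_less_top)
  finally show "(\<integral>\<^sup>+x\<in>{a..b}. ennreal (f x) \<partial>lborel) < \<infinity>" .
qed (use B in auto)

lemma integral_reflect_shift: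
  fixes f :: "real \<Rightarrow> real"
  shows "integral {a..b} (\<lambda>y. f (t - y)) = integral {t - b..t - a} f"
proof -
  have "integral {a..b} (\<lambda>y. f (t - y)) = integral {-b..-a} (\<lambda>y. f (t + y))"
    using Henstock_Kurzweil_Integration.integral_reflect_real[of b a "\<lambda>y. f (t - y)"] by simp
  also have "\<dots> = integral {t - b..t - a} f"
    using integral_shift_Icc_real[of "-b" "-a" f t] by (simp add: o_def)
  finally show ?thesis .
qed

lemma integral_bounded_continuous:
  fixes f :: "real \<Rightarrow> real"
  assumes "f \<in> borel_measurable borel" and "\<And>T. \<exists>B. \<forall>x\<in>{0..T}. \<bar>f x\<bar> \<le> B"
  shows "continuous_on {0..} (\<lambda>y. integral {0..y} f)"
proof -
  have "continuous (at y within {0..}) (\<lambda>y. integral {0..y} f)" if y: "y \<ge> 0" for y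
  proof -
    obtain B where "\<forall>x\<in>{0..y+1}. \<bar>f x\<bar> \<le> B" using assms(2) by blast
    then have "continuous_on {0..y+1} (\<lambda>y. integral {0..y} f)"
      by (intro indefinite_integral_continuous_1 bounded_borel_integrable_on assms) auto
    then have "continuous (at y within {0..y+1}) (\<lambda>y. integral {0..y} f)"
      using y by (simp add: continuous_on_eq_continuous_within)
    moreover have "at y within {0..y+1} = at y within {0..}"
      by (rule at_within_nhd[of _ "{..<y+1}"]) (use y in auto)
    ultimately show ?thesis by simp
  qed
  then show ?thesis
    by (simp add: continuous_on_eq_continuous_within)
qed

lemma borel_measurable_integral_bounded:
  fixes f :: "real \<Rightarrow> real"
  assumes f: "f \<in> borel_measurable borel" and B: "\<And>T. \<exists>B. \<forall>x\<in>{0..T}. \<bar>f x\<bar> \<le> B"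
  shows "(\<lambda>y. integral {0..y} f) \<in> borel_measurable borel"
proof -
  \<comment> \<open>Freezing the upper limit at 0 for negative \<open>y\<close> gives a function
    that is continuous on the whole line; both integrals are 0 there.\<close>
  have "continuous_on UNIV (\<lambda>y. integral {0..max 0 y} f)"
    by (rule continuous_on_compose2[OF integral_bounded_continuous[OF f B]])
       (auto intro!: continuous_intros)
  then have "(\<lambda>y. integral {0..max 0 y} f) \<in> borel_measurable borel"
    by (rule borel_measurable_continuous_onI)
  also have "(\<lambda>y. integral {0..max 0 y} f) = (\<lambda>y. integral {0..y} f)"
    by (auto simp: max_def fun_eq_iff)
  finally show ?thesis .
qed

text \<open>Over \<open>n + 1\<close> equal pieces of \<open>[0, T]\<close> the increments add up to
  at most \<open>C * T\<^sup>2 / (n + 1)\<close>, which tends to 0. An integrated equation can thus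
  be checked through second-order errors alone.\<close>

lemma constant_if_quadratic_increments:
  fixes p :: "real \<Rightarrow> real"
  assumes "0 \<le> T" and q: "\<And>a b. 0 \<le> a \<Longrightarrow> a \<le> b \<Longrightarrow> b \<le> T \<Longrightarrow> \<bar>p b - p a\<bar> \<le> C * (b - a)\<^sup>2"
  shows "p T = p 0"
proof -
  have le: "\<bar>p T - p 0\<bar> \<le> C * T\<^sup>2 / real (Suc n)" for n
  proof -
    have mono: "real i * (T / real (Suc n)) \<le> T" if "i \<le> Suc n" for i
    proof -
      have "real i * (T / real (Suc n)) \<le> real (Suc n) * (T / real (Suc n))"
        using that \<open>0 \<le> T\<close> by (intro mult_right_mono) auto
      then show ?thesis by simp
    qed
    have "\<bar>p T - p 0\<bar> = \<bar>\<Sum>i<Suc n. p (real (Suc i) * (T / real (Suc n))) - p (real i * (T / real (Suc n)))\<bar>"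
      by (subst sum_lessThan_telescope) (simp del: of_nat_Suc)
    also have "\<dots> \<le> (\<Sum>i<Suc n. C * (T / real (Suc n))\<^sup>2)"
    proof (rule order_trans[OF sum_abs sum_mono])
      fix i assume "i \<in> {..<Suc n}"
      then have "\<bar>p (real (Suc i) * (T / real (Suc n))) - p (real i * (T / real (Suc n)))\<bar>
          \<le> C * (real (Suc i) * (T / real (Suc n)) - real i * (T / real (Suc n)))\<^sup>2"
        using \<open>0 \<le> T\<close> mono[of "Suc i"] by (intro q mult_right_mono) auto
      also have "real (Suc i) * (T / real (Suc n)) - real i * (T / real (Suc n)) = T / real (Suc n)"
        by (simp only: left_diff_distrib[symmetric]) simp
      finally show "\<bar>p (real (Suc i) * (T / real (Suc n))) - p (real i * (T / real (Suc n)))\<bar>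
          \<le> C * (T / real (Suc n))\<^sup>2" .
    qed
    also have "\<dots> = C * T\<^sup>2 / real (Suc n)"
      by (simp add: power2_eq_square del: of_nat_Suc)
    finally show ?thesis .
  qed
  have "(\<lambda>n. C * T\<^sup>2 * inverse (real (Suc n))) \<longlonglongrightarrow> C * T\<^sup>2 * 0"
    by (intro tendsto_intros LIMSEQ_inverse_real_of_nat)
  then have "\<bar>p T - p 0\<bar> \<le> 0"
    using le by (intro LIMSEQ_le_const) (auto simp: divide_inverse)
  then show ?thesis by simp
qed

text \<open>This is the chain rule for \<open>exp\<close> after \<open>H\<close>, in a situation
  where \<open>h\<close> is only measurable and \<open>H\<close> need not be differentiable
  everywhere. On a short interval both sides grow by nearly \<open>exp (H a)\<close> times the
  integral of \<open>h\<close>; the discrepancy is quadratic in the length, so \<open>D\<close> is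
  constant.\<close>

lemma exp_integral_eq:
  fixes h :: "real \<Rightarrow> real"
  assumes h[measurable]: "h \<in> borel_measurable borel" and B: "\<And>x. 0 \<le> h x" "\<And>x. h x \<le> B" and "0 \<le> T"
  shows "exp (integral {0..T} h) = 1 + integral {0..T} (\<lambda>y. h y * exp (integral {0..y} h))"
proof -
  define H where "H y = integral {0..y} h" for y
  have hint: "h integrable_on {a..b}" for a b
    using B by (intro bounded_borel_integrable_on[where B=B]) auto
  have Hm[measurable]: "H \<in> borel_measurable borel"
    unfolding H_def using B by (intro borel_measurable_integral_bounded exI[of _ B]) auto
  have Hab: "H b - H a = integral {a..b} h" if "0 \<le> a" "a \<le> b" for a b
    using Henstock_Kurzweil_Integration.integral_combine[OF that hint] unfolding H_def by simp
  have Hmono: "H a \<le> H b" if "0 \<le> a" "a \<le> b" for a b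
    using Hab[OF that] B Henstock_Kurzweil_Integration.integral_nonneg[OF hint, of a b] by force
  have HB: "H b - H a \<le> B * (b - a)" if "0 \<le> a" "a \<le> b" for a b
    using Hab[OF that] integral_le[OF hint[of a b] integrable_const_ivl, of B] B that by (simp add: mult.commute)
  have B0: "0 \<le> B" using B order_trans by blast
  have kint: "(\<lambda>y. h y * exp (H y)) integrable_on {a..b}" if "0 \<le> a" "b \<le> T" for a b
    using that B B0 Hmono by (intro bounded_borel_integrable_on[where B="B * exp (H T)"])
      (auto simp: abs_mult intro!: mult_mono)
  define D where "D y = exp (H y) - integral {0..y} (\<lambda>y. h y * exp (H y))" for y
  have "D T = D 0"
  proof (rule constant_if_quadratic_increments[OF \<open>0 \<le> T\<close>])
    fix a b :: real assume ab: "0 \<le> a" "a \<le> b" "b \<le> T"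
    have inc: "exp (H b) - exp (H a) \<le> exp (H T) * (B * (b - a))"
    proof -
      have "exp (H b) - exp (H a) = exp (H b) * (1 - exp (- (H b - H a)))"
        by (simp add: right_diff_distrib exp_add[symmetric])
      also have "\<dots> \<le> exp (H T) * (H b - H a)"
      proof (intro mult_mono)
        show "1 - exp (- (H b - H a)) \<le> H b - H a"
          using exp_ge_add_one_self[of "- (H b - H a)"] by linarith
      qed (use Hmono[of a b] Hmono[of b T] ab in auto)
      also have "\<dots> \<le> exp (H T) * (B * (b - a))"
        using HB ab by (intro mult_left_mono) auto
      finally show ?thesis .
    qed
    \<comment> \<open>The mean value theorem is applied to \<open>exp\<close> between
      \<open>H a\<close> and \<open>H b\<close>, not to \<open>exp (H y)\<close> as a function of
      \<open>y\<close>. It needs \<open>H a < H b\<close>; if they coincide, both differences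
      vanish.\<close>
    have "\<exists>e. exp (H a) \<le> e \<and> e \<le> exp (H b) \<and> exp (H b) - exp (H a) = e * (H b - H a)"
    proof (cases "H a < H b")
      case True
      from MVT2[OF this, of exp exp] obtain z where "H a < z" "z < H b"
          "exp (H b) - exp (H a) = (H b - H a) * exp z" by (auto intro: DERIV_exp)
      then show ?thesis by (intro exI[of _ "exp z"]) auto
    next
      case False
      then show ?thesis using Hmono[OF ab(1,2)] by (intro exI[of _ "exp (H a)"]) auto
    qed
    then obtain e where e: "exp (H a) \<le> e" "e \<le> exp (H b)" "exp (H b) - exp (H a) = e * (H b - H a)"
      by blast
    have "D b - D a = e * integral {a..b} h - integral {a..b} (\<lambda>y. h y * exp (H y))"
      using Henstock_Kurzweil_Integration.integral_combine[OF ab(1,2) kint] ab e Hab[of a b]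
      unfolding D_def by (simp add: algebra_simps)
    also have "\<dots> = integral {a..b} (\<lambda>y. e * h y - h y * exp (H y))"
      by (subst Henstock_Kurzweil_Integration.integral_diff)
         (use ab in \<open>auto intro!: kint hint integrable_on_mult_right\<close>)
    also have "\<bar>\<dots>\<bar> \<le> (B * (exp (H T) * (B * (b - a)))) * (b - a)"
    proof -
      have "norm (integral (cbox a b) (\<lambda>y. e * h y - h y * exp (H y)))
          \<le> (B * (exp (H T) * (B * (b - a)))) * Henstock_Kurzweil_Integration.content (cbox a b)"
      proof (rule integrable_bound)
        fix y assume y: "y \<in> cbox a b"
        then have "exp (H a) \<le> exp (H y)" "exp (H y) \<le> exp (H b)"
          using ab Hmono[of a y] Hmono[of y b] by auto
        then have "\<bar>e - exp (H y)\<bar> \<le> exp (H T) * (B * (b - a))"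
          using e(1,2) inc by linarith
        then have "h y * \<bar>e - exp (H y)\<bar> \<le> B * (exp (H T) * (B * (b - a)))"
          using B B0 by (intro mult_mono) auto
        moreover have "norm (e * h y - h y * exp (H y)) = h y * \<bar>e - exp (H y)\<bar>"
        proof -
          have "e * h y - h y * exp (H y) = h y * (e - exp (H y))" by (simp add: algebra_simps)
          then show ?thesis using B(1)[of y] by (simp add: abs_mult)
        qed
        ultimately show "norm (e * h y - h y * exp (H y)) \<le> B * (exp (H T) * (B * (b - a)))" by simp
      next
        show "(\<lambda>y. e * h y - h y * exp (H y)) integrable_on cbox a b"
          using ab by (auto intro!: integrable_diff kint hint integrable_on_mult_right)
      qed (use ab B0 in auto)
      then show ?thesis using ab by simp
    qed
    finally show "\<bar>D b - D a\<bar> \<le> (B * exp (H T) * B) * (b - a)\<^sup>2"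
      by (simp add: power2_eq_square algebra_simps)
  qed
  then show ?thesis by (simp add: D_def H_def)
qed

text \<open>Gronwall by iteration: putting the bound \<open>B * (C * y) ^ n / fact n\<close> under
  the integral yields the next one, and the factorial drives these bounds to 0.\<close>

lemma Volterra_zero:
  fixes f :: "real \<Rightarrow> real"
  assumes f: "f \<in> borel_measurable borel" and B: "\<And>x. x \<in> {0..T} \<Longrightarrow> 0 \<le> f x" "\<And>x. x \<in> {0..T} \<Longrightarrow> f x \<le> B"
    and le: "\<And>y. y \<in> {0..T} \<Longrightarrow> f y \<le> C * integral {0..y} f" and "0 \<le> C" and y: "y \<in> {0..T}"
  shows "f y = 0"
proof -
  have fint: "f integrable_on {0..y}" if "y \<in> {0..T}" for y
    using B that f by (intro bounded_borel_integrable_on[where B=B]) auto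
  have step: "\<forall>y\<in>{0..T}. f y \<le> B * (C * y) ^ n / fact n" for n
  proof (induction n)
    case 0 then show ?case using B by auto
  next
    case (Suc n)
    show ?case
    proof
      fix y assume y: "y \<in> {0..T}"
      have I: "((\<lambda>x. B * (C * x) ^ n / fact n) has_integral
          (B * C ^ n / fact (Suc n) * y ^ Suc n - B * C ^ n / fact (Suc n) * 0 ^ Suc n)) {0..y}"
      proof (rule fundamental_theorem_of_calculus)
        fix x assume "x \<in> {0..y}"
        have "((\<lambda>x. B * C ^ n / fact (Suc n) * x ^ Suc n) has_real_derivative
           B * C ^ n / fact (Suc n) * (real (Suc n) * x ^ n)) (at x within {0..y})"
          by (rule DERIV_cong[OF DERIV_cmult[OF DERIV_pow]]) simp
        also have "B * C ^ n / fact (Suc n) * (real (Suc n) * x ^ n) = B * (C * x) ^ n / fact n"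
          by (simp add: power_mult_distrib fact_Suc del: of_nat_Suc)
        finally show "((\<lambda>x. B * C ^ n / fact (Suc n) * x ^ Suc n) has_vector_derivative
            B * (C * x) ^ n / fact n) (at x within {0..y})"
          by (simp add: has_real_derivative_iff_has_vector_derivative)
      qed (use y in auto)
      have "f y \<le> C * integral {0..y} f" using le y by auto
      also have "\<dots> \<le> C * (B * C ^ n / fact (Suc n) * y ^ Suc n)"
      proof (intro mult_left_mono \<open>0 \<le> C\<close>)
        have "integral {0..y} f \<le> B * C ^ n / fact (Suc n) * y ^ Suc n - B * C ^ n / fact (Suc n) * 0 ^ Suc n"
          using Suc y by (intro has_integral_le[OF integrable_integral[OF fint] I]) auto
        then show "integral {0..y} f \<le> B * C ^ n / fact (Suc n) * y ^ Suc n" by simp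
      qed
      finally show "f y \<le> B * (C * y) ^ Suc n / fact (Suc n)"
        by (simp add: power_mult_distrib mult_ac)
    qed
  qed
  have "(\<lambda>n. B * (inverse (fact n) * (C * y) ^ n)) \<longlonglongrightarrow> B * 0"
    by (intro tendsto_intros summable_LIMSEQ_zero summable_exp)
  moreover have "f y \<le> B * (inverse (fact n) * (C * y) ^ n)" for n
    using step[of n] y by (auto simp: divide_inverse mult_ac)
  ultimately have "f y \<le> 0"
    by (intro LIMSEQ_le_const) auto
  with B y show ?thesis by force
qed

text \<open>By \<open>exp_integral_eq\<close> the claimed solution satisfies the same integral
  equation, so the distance of the two obeys the inequality of \<open>Volterra_zero\<close> with
  constant \<open>B\<close>.\<close>

lemma linear_Volterra_exp:
  fixes h k :: "real \<Rightarrow> real"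
  assumes h[measurable]: "h \<in> borel_measurable borel" and B: "\<And>x. 0 \<le> h x" "\<And>x. h x \<le> B"
    and k[measurable]: "k \<in> borel_measurable borel" and C: "\<And>x. x \<in> {0..T} \<Longrightarrow> \<bar>k x\<bar> \<le> C"
    and eq: "\<And>y. y \<in> {0..T} \<Longrightarrow> k y = c + integral {0..y} (\<lambda>x. h x * k x)" and "0 \<le> T"
  shows "k T = c * exp (integral {0..T} h)"
proof -
  define H where "H y = integral {0..y} h" for y
  have Hm[measurable]: "H \<in> borel_measurable borel"
    unfolding H_def using B by (intro borel_measurable_integral_bounded exI[of _ B]) auto
  have B0: "0 \<le> B" using B order_trans by blast
  have HB: "H y \<le> B * T" if "y \<in> {0..T}" for y
  proof -
    have "H y \<le> B * y"
      using integral_le[OF bounded_borel_integrable_on[OF h, of 0 y B] integrable_const_ivl, of B] B that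
      by (simp add: H_def mult.commute)
    also have "\<dots> \<le> B * T" using that B0 by (intro mult_left_mono) auto
    finally show ?thesis .
  qed
  define f where "f y = \<bar>k y - c * exp (H y)\<bar>" for y
  have [measurable]: "f \<in> borel_measurable borel" unfolding f_def by measurable
  have ceb: "\<bar>c * exp (H y)\<bar> \<le> \<bar>c\<bar> * exp (B * T)" if "y \<in> {0..T}" for y
    using HB that by (auto simp: abs_mult intro!: mult_left_mono)
  have fb: "f y \<le> C + \<bar>c\<bar> * exp (B * T)" if "y \<in> {0..T}" for y
    using ceb[OF that] C[OF that] unfolding f_def by linarith
  have "f T = 0"
  proof (rule Volterra_zero[where f=f and y=T and T=T])
    fix y assume y: "y \<in> {0..T}"
    have i1: "(\<lambda>x. h x * k x) integrable_on {0..y}"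
      using y B C B0 by (intro bounded_borel_integrable_on[where B="B * C"]) (auto simp: abs_mult intro!: mult_mono)
    have i2: "(\<lambda>x. h x * (c * exp (H x))) integrable_on {0..y}"
    proof (rule bounded_borel_integrable_on[where B="B * (\<bar>c\<bar> * exp (B * T))"])
      fix x assume "x \<in> {0..y}"
      then have "\<bar>c * exp (H x)\<bar> \<le> \<bar>c\<bar> * exp (B * T)" using y ceb by auto
      then show "\<bar>h x * (c * exp (H x))\<bar> \<le> B * (\<bar>c\<bar> * exp (B * T))"
        unfolding abs_mult[of "h x"] using B B0 by (intro mult_mono) auto
    qed measurable
    have e: "c * exp (H y) = c + integral {0..y} (\<lambda>x. h x * (c * exp (H x)))"
    proof -
      have "exp (H y) = 1 + integral {0..y} (\<lambda>x. h x * exp (H x))"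
        using exp_integral_eq[OF h B, of y] y unfolding H_def by auto
      then have "c * exp (H y) = c + c * integral {0..y} (\<lambda>x. h x * exp (H x))" by (simp add: algebra_simps)
      then show ?thesis by (simp add: mult.left_commute)
    qed
    have "f y = \<bar>integral {0..y} (\<lambda>x. h x * k x - h x * (c * exp (H x)))\<bar>"
      unfolding f_def eq[OF y] e using i1 i2 by (simp add: Henstock_Kurzweil_Integration.integral_diff)
    also have "\<dots> \<le> integral {0..y} (\<lambda>x. B * f x)"
      unfolding real_norm_def[symmetric]
    proof (rule integral_norm_bound_integral)
      show "(\<lambda>x. h x * k x - h x * (c * exp (H x))) integrable_on {0..y}"
        using i1 i2 by (rule integrable_diff)
      show "(\<lambda>x. B * f x) integrable_on {0..y}"
        using y fb B0 by (intro bounded_borel_integrable_on[where B="B * (C + \<bar>c\<bar> * exp (B * T))"])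
           (auto simp: abs_mult f_def intro!: mult_left_mono)
      fix x
      have "norm (h x * k x - h x * (c * exp (H x))) = h x * f x"
        using B by (simp add: f_def right_diff_distrib[symmetric] abs_mult)
      also have "\<dots> \<le> B * f x"
        using B by (intro mult_right_mono) (auto simp: f_def)
      finally show "norm (h x * k x - h x * (c * exp (H x))) \<le> B * f x" .
    qed
    finally show "f y \<le> B * integral {0..y} f" by simp
  qed (use fb B0 \<open>0 \<le> T\<close> in \<open>auto simp: f_def\<close>)
  then show ?thesis by (simp add: f_def H_def)
qed

text \<open>The kernel is at most 1, hence the distance of two solutions is at most \<open>d\<close>
  times its own integral. This will identify the functions \<open>U s\<close> for different
  \<open>s\<close>.\<close>

lemma renewal_unique:
  fixes W1 W2 m :: "real \<Rightarrow> real"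
  assumes [measurable]: "W1 \<in> borel_measurable borel" "W2 \<in> borel_measurable borel" "m \<in> borel_measurable borel"
    and m: "\<And>x. 0 \<le> m x" "\<And>x. m x \<le> 1"
    and B: "\<And>x. x \<in> {0..T} \<Longrightarrow> \<bar>W1 x\<bar> \<le> B" "\<And>x. x \<in> {0..T} \<Longrightarrow> \<bar>W2 x\<bar> \<le> B"
    and eq: "\<And>t. t \<in> {0..T} \<Longrightarrow> W1 t = 1 + d * integral {0..t} (\<lambda>y. W1 y * m (t - y))"
      "\<And>t. t \<in> {0..T} \<Longrightarrow> W2 t = 1 + d * integral {0..t} (\<lambda>y. W2 y * m (t - y))"
    and "0 \<le> d" "0 \<le> T"
  shows "W1 T = W2 T"
proof -
  define f where "f y = \<bar>W1 y - W2 y\<bar>" for y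
  have [measurable]: "f \<in> borel_measurable borel" unfolding f_def by measurable
  have fb: "f y \<le> 2 * B" if "y \<in> {0..T}" for y
    using B[OF that] unfolding f_def by linarith
  have "f T = 0"
  proof (rule Volterra_zero[where f=f and y=T and T=T])
    fix t assume t: "t \<in> {0..T}"
    have i: "(\<lambda>y. W y * m (t - y)) integrable_on {0..t}"
      if [measurable]: "W \<in> borel_measurable borel" and W: "\<And>x. x \<in> {0..T} \<Longrightarrow> \<bar>W x\<bar> \<le> B" for W
    proof (rule bounded_borel_integrable_on[where B="B * 1"])
      fix y assume "y \<in> {0..t}"
      then have "\<bar>W y\<bar> \<le> B" using t W by auto
      then show "\<bar>W y * m (t - y)\<bar> \<le> B * 1"
        unfolding abs_mult using m by (intro mult_mono) auto
    qed measurable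
    have "W1 t - W2 t = d * (integral {0..t} (\<lambda>y. W1 y * m (t - y)) - integral {0..t} (\<lambda>y. W2 y * m (t - y)))"
      using eq(1)[OF t] eq(2)[OF t] unfolding right_diff_distrib by linarith
    also have "\<dots> = d * integral {0..t} (\<lambda>y. W1 y * m (t - y) - W2 y * m (t - y))"
      using i[of W1] i[of W2] B by (subst Henstock_Kurzweil_Integration.integral_diff) auto
    finally have "f t = d * \<bar>integral {0..t} (\<lambda>y. W1 y * m (t - y) - W2 y * m (t - y))\<bar>"
      unfolding f_def using \<open>0 \<le> d\<close> by (simp add: abs_mult)
    also have "\<dots> \<le> d * integral {0..t} f"
      unfolding real_norm_def[symmetric]
    proof (intro mult_left_mono integral_norm_bound_integral)
      show "(\<lambda>y. W1 y * m (t - y) - W2 y * m (t - y)) integrable_on {0..t}"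
        using i[of W1] i[of W2] B by (intro integrable_diff) auto
      show "f integrable_on {0..t}"
        using fb t by (intro bounded_borel_integrable_on[where B="2*B"]) (auto simp: f_def)
      fix y
      have "norm (W1 y * m (t - y) - W2 y * m (t - y)) = f y * m (t - y)"
        using m by (simp add: f_def left_diff_distrib[symmetric] abs_mult)
      also have "\<dots> \<le> f y * 1"
        using m by (intro mult_left_mono) (auto simp: f_def)
      finally show "norm (W1 y * m (t - y) - W2 y * m (t - y)) \<le> f y" by simp
    qed (use \<open>0 \<le> d\<close> in auto)
    finally show "f t \<le> d * integral {0..t} f" .
  qed (use fb \<open>0 \<le> T\<close> \<open>0 \<le> d\<close> in \<open>auto simp: f_def\<close>)
  then show ?thesis by (simp add: f_def)
qed

text \<open>The generating functions below are available for \<open>0 < s < 1\<close> only, so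
  coefficients are compared from the right of 0. If \<open>m\<close> is the first index where they
  differ, dividing the difference by \<open>s ^ m\<close> and letting \<open>s\<close> tend to 0
  isolates a coefficient that must vanish.\<close>

lemma powser_unique_right:
  fixes a b :: "nat \<Rightarrow> real"
  assumes "\<And>s. 0 < s \<Longrightarrow> s < 1 \<Longrightarrow> (\<lambda>n. a n * s ^ n) sums f s"
    and "\<And>s. 0 < s \<Longrightarrow> s < 1 \<Longrightarrow> (\<lambda>n. b n * s ^ n) sums f s"
  shows "a = b"
proof (rule ccontr)
  define c where "c n = a n - b n" for n
  have c: "(\<lambda>n. c n * s ^ n) sums 0" if "0 < s" "s < 1" for s
    using sums_diff[OF assms(1)[OF that] assms(2)[OF that]] by (simp add: c_def left_diff_distrib)
  assume "a \<noteq> b"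
  then have ex: "\<exists>n. c n \<noteq> 0" by (auto simp: c_def)
  define m where "m = (LEAST n. c n \<noteq> 0)"
  have m: "c m \<noteq> 0" "\<And>n. n < m \<Longrightarrow> c n = 0"
    unfolding m_def using LeastI_ex[OF ex] not_less_Least by fast+
  have s0: "(\<lambda>n. c (n + m) * s ^ n) sums 0" if s: "0 < s" "s < 1" for s
  proof -
    have "(\<lambda>n. c (n + m) * s ^ (n + m)) sums (0 - (\<Sum>i<m. c i * s ^ i))"
      using sums_split_initial_segment[OF c[OF s], of m] .
    moreover have "(\<Sum>i<m. c i * s ^ i) = 0" using m(2) by (intro sum.neutral) auto
    ultimately have "(\<lambda>n. c (n + m) * s ^ (n + m)) sums 0" by (simp only: diff_0_right)
    from sums_mult[OF this, of "1 / s ^ m"] show ?thesis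
      using s by (simp add: power_add)
  qed
  \<comment> \<open>Convergence at the single point \<open>1/2\<close> gives convergence on both
    sides of 0, as the limit of a power series at 0 requires.\<close>
  have sm: "summable (\<lambda>n. c (n + m) * x ^ n)" if "norm x < 1/2" for x
    by (rule powser_inside[OF sums_summable[OF s0[of "1/2"]]]) (use that in auto)
  define g where "g x = (\<Sum>n. c (n + m) * x ^ n)" for x
  have "(g \<longlongrightarrow> c (0 + m)) (at 0)"
  proof (rule powser_limit_0[where s="1/2"])
    show "(\<lambda>n. c (n + m) * x ^ n) sums g x" if "norm x < 1/2" for x
      unfolding g_def by (rule summable_sums[OF sm[OF that]])
  qed simp
  then have "(g \<longlongrightarrow> c m) (at_right 0)"
    unfolding add_0 by (rule tendsto_within_subset) simp
  moreover have "eventually (\<lambda>x. g x = 0) (at_right (0::real))"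
    using eventually_at_right_real[of 0 "1::real"]
  proof (rule eventually_mono)
    fix x :: real assume "x \<in> {0<..<1}"
    then show "g x = 0" unfolding g_def using s0[of x] by (intro sums_unique[symmetric]) auto
  qed simp
  ultimately have "((\<lambda>_. 0) \<longlongrightarrow> c m) (at_right (0::real))"
    by (rule Lim_transform_eventually)
  then have "c m = 0"
    by (rule tendsto_unique[OF trivial_limit_at_right_real _ tendsto_const])
  with m show False by simp
qed

section \<open>The tree at the first birth\<close>

text \<open>Labels grow at the front, so the last entry tells through which child of the ancestor a
  line descends. Once the first child is split off, the remaining children are renumbered from 0;
  this map restores their original rank. Appending \<open>[0]\<close> does the same for the tree of
  the first child.\<close>

definition later :: "individual \<Rightarrow> individual" where
  "later u = (if u = [] then [] else butlast u @ [Suc (last u)])"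

lemma later_Nil [simp]: "later [] = []"
  and later_singleton [simp]: "later [j] = [Suc j]"
  and later_Cons: "u \<noteq> [] \<Longrightarrow> later (j # u) = j # later u"
  and later_snoc [simp]: "later (u @ [j]) = u @ [Suc j]"
  and later_eq_Nil_iff [simp]: "later u = [] \<longleftrightarrow> u = []" "[] = later u \<longleftrightarrow> u = []"
  by (auto simp: later_def)

lemma inj_later: "inj later"
proof (rule injI)
  fix u v assume "later u = later v"
  then show "u = v"
    by (cases u rule: rev_cases; cases v rule: rev_cases) auto
qed

text \<open>These are the ancestor, the tree of its first child and the trees of its later children.
  The ancestor joins the third group as \<open>later []\<close>, which gives the two halves of the
  split at the first birth.\<close>

lemma individual_cases:
  obtains "u = []" | v where "u = v @ [0]" | v where "v \<noteq> []" "u = later v"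
proof (cases u rule: rev_cases)
  case (snoc v j)
  then show ?thesis using that(2)[of v] that(3)[of "v @ [j - 1]"] by (cases j) auto
qed (use that in auto)

lemma later_neq_snoc_0 [simp]: "later v \<noteq> u @ [0]" "u @ [0] \<noteq> later v"
  by (cases v rule: rev_cases; auto)+

lemma birth_age_0: "birth_age v 0 = v 0"
  by (simp add: birth_age_def)

lemma birth_age_Suc_shift: "birth_age v (Suc i) = v 0 + birth_age (\<lambda>j. v (Suc j)) i"
  by (simp add: birth_age_def sum.atMost_Suc_shift del: sum.atMost_Suc)

lemma birth_time_snoc_0: "birth_time w (u @ [0]) = w [] 0 + birth_time (\<lambda>u. w (u @ [0])) u"
  by (induction u) (auto simp: birth_age_0 add_ac)

lemma born_snoc_0:
  "born l w (u @ [0]) \<longleftrightarrow> w [] 0 < ennreal (l []) \<and> born (\<lambda>u. l (u @ [0])) (\<lambda>u. w (u @ [0])) u"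
  by (induction u) (auto simp: birth_age_0)

text \<open>
  The part of the population that does not descend from the first child of the ancestor is a tree
  whose ancestor starts at the first birth, with the remaining life \<open>r\<close>.
\<close>

definition rest_life :: "(individual \<Rightarrow> real) \<Rightarrow> real \<Rightarrow> individual \<Rightarrow> real" where
  "rest_life l r u = (if u = [] then r else l (later u))"

definition rest_wait :: "(individual \<Rightarrow> nat \<Rightarrow> ennreal) \<Rightarrow> individual \<Rightarrow> nat \<Rightarrow> ennreal" where
  "rest_wait w u i = (if u = [] then w [] (Suc i) else w (later u) i)"

text \<open>The ancestor is excluded: it is born at 0, whereas the restarted tree begins at the
  first birth.\<close>

lemma birth_time_later: "u \<noteq> [] \<Longrightarrow> birth_time w (later u) = w [] 0 + birth_time (rest_wait w) u"
proof (induction u)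
  case (Cons i u)
  show ?case
  proof (cases "u = []")
    case True
    then show ?thesis by (simp add: birth_age_Suc_shift rest_wait_def[abs_def])
  next
    case False
    then show ?thesis
      using Cons by (simp add: later_Cons add.assoc rest_wait_def[of w u, abs_def])
  qed
qed simp

lemma ennreal_add_less_iff:
  assumes "0 \<le> x" "x < r"
  shows "ennreal x + a < ennreal r \<longleftrightarrow> a < ennreal (r - x)"
  using assms by (cases a) (auto simp: ennreal_less_iff simp flip: ennreal_plus)

lemma born_later:
  assumes "w [] 0 = ennreal x" "0 \<le> x" "x < l []"
  shows "born l w (later u) \<longleftrightarrow> born (rest_life l (l [] - x)) (rest_wait w) u"
proof (induction u)
  case (Cons i u)
  show ?case
  proof (cases "u = []")
    case True
    then show ?thesis
      using assms by (simp add: birth_age_Suc_shift rest_wait_def[abs_def] rest_life_def ennreal_add_less_iff)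
  next
    case False
    then show ?thesis
      using Cons by (simp add: later_Cons rest_wait_def[of w u, abs_def] rest_life_def)
  qed
qed simp

lemma ennreal_add_le_iff:
  assumes "0 \<le> x" "x \<le> t"
  shows "ennreal x + a \<le> ennreal t \<longleftrightarrow> a \<le> ennreal (t - x)"
  using assms by (cases a) (auto simp: top_unique simp flip: ennreal_plus)

lemma ennreal_less_add_iff:
  assumes "0 \<le> x" "x \<le> t"
  shows "ennreal t < ennreal x + b \<longleftrightarrow> ennreal (t - x) < b"
  using assms by (cases b) (auto simp: ennreal_less_iff simp flip: ennreal_plus)

lemma alive_first_birth:
  assumes x: "w [] 0 = ennreal x" "0 \<le> x" "x < l []" "x \<le> t"
  shows "alive l w t =
    (\<lambda>u. u @ [0]) ` alive (\<lambda>u. l (u @ [0])) (\<lambda>u. w (u @ [0])) (t - x)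
    \<union> later ` alive (rest_life l (l [] - x)) (rest_wait w) (t - x)" (is "_ = ?C \<union> ?R")
proof -
  have C: "u @ [0] \<in> alive l w t \<longleftrightarrow> u \<in> alive (\<lambda>u. l (u @ [0])) (\<lambda>u. w (u @ [0])) (t - x)" for u
    using x by (simp add: alive_def born_snoc_0 birth_time_snoc_0 add.assoc ennreal_add_le_iff ennreal_less_add_iff ennreal_less_iff)
  have R: "later u \<in> alive l w t \<longleftrightarrow> u \<in> alive (rest_life l (l [] - x)) (rest_wait w) (t - x)" for u
  proof (cases "u = []")
    \<comment> \<open>\<open>birth_time_later\<close> does not cover the ancestor, who is older than
      \<open>x\<close>. As \<open>x \<le> t\<close>, it is alive exactly if its remaining life
      exceeds \<open>t - x\<close>.\<close>
    case True
    then show ?thesis using x by (simp add: alive_def rest_life_def ennreal_less_iff)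
  next
    case False
    moreover from False have "l (later u) = rest_life l (l [] - x) u" by (simp add: rest_life_def)
    ultimately show ?thesis
      using x by (simp add: alive_def born_later birth_time_later add.assoc ennreal_add_le_iff ennreal_less_add_iff)
  qed
  show ?thesis
  proof (rule set_eqI)
    fix u
    show "u \<in> alive l w t \<longleftrightarrow> u \<in> ?C \<union> ?R"
    proof (cases u rule: individual_cases)
      case 1
      then show ?thesis using R[of "[]"] by (auto simp: image_iff)
    next
      case (2 v)
      then show ?thesis using C[of v] by (auto simp: image_iff)
    next
      case (3 v)
      then show ?thesis using R[of v] injD[OF inj_later] by (auto simp: image_iff)
    qed
  qed
qed

lemma born_first_wait:
  "u \<noteq> [] \<Longrightarrow> born l w u \<Longrightarrow> w [] 0 < ennreal (l []) \<and> w [] 0 \<le> birth_time w u"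
proof (induction u)
  case (Cons i u)
  have le: "v 0 \<le> birth_age v i" for v :: "nat \<Rightarrow> ennreal"
    unfolding birth_age_def by (rule member_le_sum) auto
  show ?case
  proof (cases "u = []")
    case True
    then show ?thesis using Cons.prems le[of "w []"] by auto
  next
    case False
    then show ?thesis using Cons by (auto intro: add_increasing2)
  qed
qed simp

lemma alive_no_birth:
  assumes "0 \<le> t" "\<not> (w [] 0 < ennreal (l []) \<and> w [] 0 \<le> ennreal t)"
  shows "alive l w t = (if t < l [] then {[]} else {})"
proof -
  have "u = []" if "u \<in> alive l w t" for u
    using that born_first_wait[of u l w] assms by (auto simp: alive_def dest: order_trans)
  moreover have "[] \<in> alive l w t \<longleftrightarrow> t < l []"
    using assms by (simp add: alive_def ennreal_less_iff)
  ultimately show ?thesis by auto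
qed

section \<open>Configurations, and the restart at the first birth in terms of their
  coordinates\<close>

type_synonym config = "individual \<times> nat \<Rightarrow> ennreal"

text \<open>
  A configuration carries the life-length of \<open>u\<close> at \<open>(u, 0)\<close> and its waiting times at
  \<open>(u, Suc i)\<close>. The life of the ancestor is a separate argument, because it changes when the
  process is restarted at the first birth.
\<close>

definition config_life :: "config \<Rightarrow> individual \<Rightarrow> real" where
  "config_life z u = enn2real (z (u, 0))"

definition config_wait :: "config \<Rightarrow> individual \<Rightarrow> nat \<Rightarrow> ennreal" where
  "config_wait z u i = z (u, Suc i)"

text \<open>Counting in \<open>ennreal\<close> makes sizes of disjoint parts add without a
  finiteness proviso.\<close>

definition pop_root :: "real \<Rightarrow> config \<Rightarrow> real \<Rightarrow> ennreal" where
  "pop_root r z t = emeasure (count_space UNIV) (alive ((config_life z)([] := r)) (config_wait z) t)"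

definition child_index :: "individual \<times> nat \<Rightarrow> individual \<times> nat" where
  "child_index = (\<lambda>(u, j). (u @ [0], j))"

text \<open>The waiting times of the ancestor (\<open>j \<noteq> 0\<close>) move up by one and free
  the coordinate \<open>([], Suc 0)\<close> of the first waiting time, while its life stays at
  \<open>([], 0)\<close>. Together with \<open>child_index\<close> and that free coordinate, this
  exhausts all coordinates without overlap.\<close>

definition rest_index :: "individual \<times> nat \<Rightarrow> individual \<times> nat" where
  "rest_index = (\<lambda>(u, j). if u = [] \<and> j \<noteq> 0 then ([], Suc j) else (later u, j))"

lemma inj_child_index: "inj child_index"
  by (auto simp: child_index_def inj_on_def)

lemma inj_rest_index: "inj rest_index"
  by (auto simp: rest_index_def inj_on_def dest: injD[OF inj_later] split: if_splits)

lemma index_partition: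
  "range child_index \<inter> range rest_index = {}"
  "([], Suc 0) \<notin> range child_index" "([], Suc 0) \<notin> range rest_index"
  "insert ([], Suc 0) (range child_index \<union> range rest_index) = UNIV"
proof -
  show "range child_index \<inter> range rest_index = {}" "([], Suc 0) \<notin> range child_index"
    "([], Suc 0) \<notin> range rest_index"
    by (auto simp: child_index_def rest_index_def split: if_splits)
  have "(u, j) \<in> insert ([], Suc 0) (range child_index \<union> range rest_index)" for u j
  proof (cases u rule: individual_cases)
    case 1
    consider "j = 0" | "j = Suc 0" | i where "j = Suc (Suc i)"
      by (cases j; cases "j - 1") auto
    then show ?thesis
    proof cases
      case 1
      then have "(u, j) = rest_index ([], 0)" using \<open>u = []\<close> by (simp add: rest_index_def)
      then show ?thesis by blast
    next
      case (3 i)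
      then have "(u, j) = rest_index ([], Suc i)" using \<open>u = []\<close> by (simp add: rest_index_def)
      then show ?thesis by blast
    qed (use \<open>u = []\<close> in simp)
  next
    case (2 v)
    then have "(u, j) = child_index (v, j)" by (simp add: child_index_def)
    then show ?thesis by blast
  next
    case (3 v)
    then have "(u, j) = rest_index (v, j)" by (simp add: rest_index_def)
    then show ?thesis by blast
  qed
  then show "insert ([], Suc 0) (range child_index \<union> range rest_index) = UNIV"
    by auto
qed

lemma emeasure_count_space_inj_image:
  assumes "inj f"
  shows "emeasure (count_space UNIV) (f ` A) = emeasure (count_space UNIV) A"
proof -
  have "inj_on f A" using assms by (rule inj_on_subset) simp
  then show ?thesis by (simp add: emeasure_count_space finite_image_iff card_image)
qed

text \<open>The two parts of \<open>alive_first_birth\<close> are disjoint images under injections,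
  so their counts add. The first child takes its life from its own coordinate, whereas the old
  ancestor goes on with \<open>r - x\<close>.\<close>

lemma pop_root_first_birth:
  assumes x: "z ([], Suc 0) = ennreal x" "0 \<le> x" "x < r" "x \<le> t"
  shows "pop_root r z t =
    pop_root (config_life (z \<circ> child_index) []) (z \<circ> child_index) (t - x)
    + pop_root (r - x) (z \<circ> rest_index) (t - x)"
proof -
  let ?l = "(config_life z)([] := r)" and ?w = "config_wait z"
  have c: "(\<lambda>u. ?l (u @ [0])) = (config_life (z \<circ> child_index))([] := config_life (z \<circ> child_index) [])"
    "(\<lambda>u. ?w (u @ [0])) = config_wait (z \<circ> child_index)"
    by (auto simp: fun_eq_iff config_life_def config_wait_def child_index_def)
  have r: "rest_life ?l (r - x) = (config_life (z \<circ> rest_index))([] := r - x)"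
    "rest_wait ?w = config_wait (z \<circ> rest_index)"
    by (auto simp: fun_eq_iff config_life_def config_wait_def rest_index_def rest_life_def rest_wait_def)
  have a: "alive ?l ?w t = (\<lambda>u. u @ [0]) ` alive (\<lambda>u. ?l (u @ [0])) (\<lambda>u. ?w (u @ [0])) (t - x)
    \<union> later ` alive (rest_life ?l (?l [] - x)) (rest_wait ?w) (t - x)"
    using x by (intro alive_first_birth) (auto simp: config_wait_def)
  have eq: "emeasure (count_space UNIV) (alive ?l ?w t) =
    emeasure (count_space UNIV) (alive (\<lambda>u. ?l (u @ [0])) (\<lambda>u. ?w (u @ [0])) (t - x)) +
    emeasure (count_space UNIV) (alive (rest_life ?l (?l [] - x)) (rest_wait ?w) (t - x))"
    by (subst a, subst plus_emeasure[symmetric])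
       (auto simp: emeasure_count_space_inj_image[OF inj_later] emeasure_count_space_inj_image inj_on_def)
  then show ?thesis
    by (simp only: pop_root_def c r fun_upd_same)
qed

lemma pop_root_no_birth:
  assumes "0 \<le> t" "\<not> (z ([], Suc 0) < ennreal r \<and> z ([], Suc 0) \<le> ennreal t)"
  shows "pop_root r z t = of_bool (t < r)"
  unfolding pop_root_def using assms
  by (subst alive_no_birth) (auto simp: config_wait_def emeasure_count_space)

lemma measurable_config [measurable]:
  assumes [measurable]: "g \<in> measurable M (PiM UNIV (\<lambda>_. borel))"
  shows "(\<lambda>x. config_wait (g x) u i) \<in> borel_measurable M"
    and "(\<lambda>x. config_life (g x) u) \<in> borel_measurable M"
  unfolding config_wait_def config_life_def by measurable

lemma measurable_birth_time:
  assumes [measurable]: "\<And>u i. (\<lambda>x. w x u i) \<in> borel_measurable M"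
  shows "(\<lambda>x. birth_time (w x) u) \<in> borel_measurable M"
proof (induction u)
  case (Cons i u)
  note [measurable] = Cons
  show ?case unfolding birth_time.simps birth_age_def by measurable
qed simp

lemma measurable_born:
  assumes [measurable]: "\<And>u i. (\<lambda>x. w x u i) \<in> borel_measurable M"
    "\<And>u. (\<lambda>x. l x u) \<in> borel_measurable M"
  shows "Measurable.pred M (\<lambda>x. born (l x) (w x) u)"
proof (induction u)
  case (Cons i u)
  note [measurable] = Cons
  show ?case unfolding born.simps birth_age_def by measurable
qed simp

text \<open>The size is a sum of indicators over the countably many labels, so it suffices that each
  single label is alive on a measurable set.\<close>

lemma measurable_pop_root [measurable]:
  assumes [measurable]: "f \<in> borel_measurable M" "g \<in> measurable M (PiM UNIV (\<lambda>_. borel))" "h \<in> borel_measurable M"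
  shows "(\<lambda>x. pop_root (f x) (g x) (h x)) \<in> borel_measurable M"
proof -
  have l [measurable]: "(\<lambda>x. ((config_life (g x))([] := f x)) u) \<in> borel_measurable M" for u
    by (cases "u = []") auto
  note [measurable] = measurable_born measurable_birth_time
  define A where "A x = alive ((config_life (g x))([] := f x)) (config_wait (g x)) (h x)" for x
  have "Measurable.pred M (\<lambda>x. u \<in> A x)" for u
    unfolding A_def alive_def mem_Collect_eq by measurable
  then have a: "(\<lambda>x. indicator (A x) u :: ennreal) \<in> borel_measurable M" for u
    by (simp add: indicator_def of_bool_def measurable_If)
  have "(\<lambda>x. \<integral>\<^sup>+u. indicator (A x) u \<partial>count_space UNIV) \<in> borel_measurable M"
  proof (rule sigma_finite_measure.borel_measurable_nn_integral[OF sigma_finite_measure_count_space_countable])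
    show "(\<lambda>(x, u). indicator (A x) u :: ennreal) \<in> borel_measurable (M \<Otimes>\<^sub>M count_space UNIV)"
      unfolding split_beta'
      by (rule measurable_compose_countable[where g=snd and f="\<lambda>u p. indicator (A (fst p)) u"])
         (auto intro: measurable_compose[OF measurable_fst a])
  qed auto
  then show ?thesis
    by (simp add: pop_root_def A_def)
qed

section \<open>Product measures\<close>

lemma prod_emb_UNIV_borel:
  assumes "\<And>k. sets (\<rho> k) = sets borel"
  shows "prod_emb UNIV \<rho> J (Pi\<^sub>E J A) = {z. \<forall>k\<in>J. z k \<in> A k}"
proof -
  have "space (\<rho> k) = UNIV" for k using sets_eq_imp_space_eq[OF assms[of k]] by simp
  then show ?thesis by (auto simp: prod_emb_def PiE_iff restrict_def)
qed

lemma emeasure_PiM_cylinder: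
  assumes "\<And>k. prob_space (\<rho> k)" and "\<And>k. sets (\<rho> k) = sets borel"
    and "finite J" and "\<And>k. k \<in> J \<Longrightarrow> A k \<in> sets borel"
  shows "emeasure (PiM UNIV \<rho>) {z. \<forall>k\<in>J. z k \<in> A k} = (\<Prod>k\<in>J. emeasure (\<rho> k) (A k))"
  using emeasure_PiM_emb[of UNIV \<rho> J A] assms by (simp add: prod_emb_UNIV_borel)

lemma PiM_eqI_cylinder:
  fixes \<rho> :: "'i \<Rightarrow> 'a :: topological_space measure"
  assumes \<rho>: "\<And>k. prob_space (\<rho> k)" "\<And>k. sets (\<rho> k) = sets borel"
    and P: "sets P = sets (PiM UNIV (\<lambda>_::'i. borel :: 'a measure))"
    and eq: "\<And>J A. finite J \<Longrightarrow> (\<And>k. A k \<in> sets borel) \<Longrightarrow>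
       emeasure P {z. \<forall>k\<in>J. z k \<in> A k} = (\<Prod>k\<in>J. emeasure (\<rho> k) (A k))"
  shows "P = PiM UNIV \<rho>"
proof (rule measure_eqI_PiM_infinite[symmetric, OF refl])
  interpret prob_space "PiM UNIV \<rho>" by (intro prob_space_PiM \<rho>)
  show "finite_measure (PiM UNIV \<rho>)" by unfold_locales
  show "sets P = sets (PiM UNIV \<rho>)"
    unfolding P by (intro sets_PiM_cong) (auto simp: \<rho>)
  fix A J assume J: "finite J" and A: "\<And>k. k \<in> J \<Longrightarrow> A k \<in> sets (\<rho> k)"
  \<comment> \<open>The hypothesis \<open>eq\<close> asks for Borel sets at all indices, but
    \<open>A\<close> is controlled on \<open>J\<close> only; \<open>{}\<close> is a Borel default at
    the other indices, which do not enter the cylinder.\<close>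
  define A' where "A' k = (if k \<in> J then A k else {})" for k
  have A': "\<And>k. A' k \<in> sets borel"
    using A by (auto simp: A'_def \<rho>)
  have "emeasure (PiM UNIV \<rho>) {z. \<forall>k\<in>J. z k \<in> A' k} = emeasure P {z. \<forall>k\<in>J. z k \<in> A' k}"
    by (simp only: eq[OF J A'] emeasure_PiM_cylinder[OF \<rho> J A'])
  moreover have "{z. \<forall>k\<in>J. z k \<in> A' k} = {z. \<forall>k\<in>J. z k \<in> A k}"
    by (auto simp: A'_def)
  ultimately show "emeasure (PiM UNIV \<rho>) (prod_emb UNIV \<rho> J (Pi\<^sub>E J A)) = emeasure P (prod_emb UNIV \<rho> J (Pi\<^sub>E J A))"
    by (simp only: prod_emb_UNIV_borel[OF \<rho>(2)])
qed

lemma measurable_PiM_UNIV_borelI: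
  assumes "\<And>k. (\<lambda>x. f x k) \<in> borel_measurable M"
  shows "f \<in> measurable M (PiM UNIV (\<lambda>_. borel))"
  using assms by (intro measurable_PiM_single') (auto simp: space_PiM)

text \<open>Resampling one coordinate independently preserves the product law. With
  \<open>k0\<close> the life of the ancestor, this makes it possible to integrate over that life
  separately.\<close>

lemma distr_PiM_update:
  fixes \<rho> :: "'i \<Rightarrow> 'a :: topological_space measure"
  assumes \<rho>: "\<And>k. prob_space (\<rho> k)" "\<And>k. sets (\<rho> k) = sets borel"
  shows "distr (\<rho> k0 \<Otimes>\<^sub>M PiM UNIV \<rho>) (PiM UNIV (\<lambda>_. borel)) (\<lambda>(x, z). z(k0 := x)) = PiM UNIV \<rho>"
proof (rule PiM_eqI_cylinder[OF \<rho>])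
  interpret prob_space "PiM UNIV \<rho>" by (intro prob_space_PiM \<rho>)
  have [measurable_cong]: "sets (PiM UNIV \<rho>) = sets (PiM UNIV (\<lambda>_. borel))" "sets (\<rho> k) = sets borel" for k
    by (auto intro!: sets_PiM_cong simp: \<rho>)
  have [simp]: "space (\<rho> k) = UNIV" for k using sets_eq_imp_space_eq[OF \<rho>(2)[of k]] by simp
  have [measurable]: "(\<lambda>(x, z). z(k0 := x)) \<in> measurable (\<rho> k0 \<Otimes>\<^sub>M PiM UNIV \<rho>) (PiM UNIV (\<lambda>_. borel))"
    by (rule measurable_PiM_UNIV_borelI) (simp add: split_beta' fun_upd_def; measurable)
  fix J :: "'i set" and A :: "'i \<Rightarrow> 'a set" assume J: "finite J" and A: "\<And>k. A k \<in> sets (borel :: 'a measure)"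
  note [measurable] = A
  have cyl: "{z. \<forall>k\<in>K. z k \<in> A k} \<in> sets (PiM UNIV (\<lambda>_. borel))" if "K \<subseteq> J" for K
  proof -
    have [simp]: "finite K" using that J finite_subset by blast
    have "Measurable.pred (PiM UNIV (\<lambda>_. borel)) (\<lambda>z. \<forall>k\<in>K. z k \<in> A k)" by measurable
    then show ?thesis by (simp add: pred_def space_PiM)
  qed
  let ?S = "if k0 \<in> J then A k0 else UNIV"
  have "emeasure (distr (\<rho> k0 \<Otimes>\<^sub>M PiM UNIV \<rho>) (PiM UNIV (\<lambda>_. borel)) (\<lambda>(x, z). z(k0 := x))) {z. \<forall>k\<in>J. z k \<in> A k}
     = emeasure (\<rho> k0 \<Otimes>\<^sub>M PiM UNIV \<rho>) (?S \<times> {z. \<forall>k\<in>J - {k0}. z k \<in> A k})"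
    by (subst emeasure_distr) (auto intro!: cyl arg_cong[where f="emeasure _"] simp: space_pair_measure space_PiM split: if_splits)
  also have "\<dots> = emeasure (\<rho> k0) ?S * (\<Prod>k\<in>J - {k0}. emeasure (\<rho> k) (A k))"
    using J A cyl[of "J - {k0}"] by (subst emeasure_pair_measure_Times) (auto simp: \<rho> emeasure_PiM_cylinder)
  also have "\<dots> = (\<Prod>k\<in>J. emeasure (\<rho> k) (A k))"
    using J prob_space.emeasure_space_1[OF \<rho>(1), of k0] by (simp add: prod.remove)
  finally show "emeasure (distr (\<rho> k0 \<Otimes>\<^sub>M PiM UNIV \<rho>) (PiM UNIV (\<lambda>_. borel)) (\<lambda>(x, z). z(k0 := x))) {z. \<forall>k\<in>J. z k \<in> A k}
     = (\<Prod>k\<in>J. emeasure (\<rho> k) (A k))" .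
qed simp

text \<open>A product configuration can be glued from one coordinate and two independent copies of
  itself, because \<open>f\<close> and \<open>g\<close> preserve the marginals and their ranges
  together with \<open>k0\<close> partition the indices. For the first waiting time and the two
  index maps, this is the independence of the two trees after the first birth.\<close>

lemma distr_PiM_split:
  fixes \<rho> :: "'i \<Rightarrow> 'a :: topological_space measure"
  assumes \<rho>: "\<And>k. prob_space (\<rho> k)" "\<And>k. sets (\<rho> k) = sets borel"
    and f: "inj f" "\<And>k. \<rho> (f k) = \<rho> k" and g: "inj g" "\<And>k. \<rho> (g k) = \<rho> k"
    and part: "range f \<inter> range g = {}" "k0 \<notin> range f" "k0 \<notin> range g" "insert k0 (range f \<union> range g) = UNIV"
  defines "c \<equiv> \<lambda>(x, a, b) k. if k = k0 then x else if k \<in> range f then a (inv f k) else b (inv g k)"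
  shows "distr (\<rho> k0 \<Otimes>\<^sub>M PiM UNIV \<rho> \<Otimes>\<^sub>M PiM UNIV \<rho>) (PiM UNIV (\<lambda>_. borel)) c = PiM UNIV \<rho>"
    and "c \<in> measurable (\<rho> k0 \<Otimes>\<^sub>M PiM UNIV \<rho> \<Otimes>\<^sub>M PiM UNIV \<rho>) (PiM UNIV (\<lambda>_. borel))"
    and "c (x, a, b) k0 = x" "c (x, a, b) \<circ> f = a" "c (x, a, b) \<circ> g = b"
proof -
  interpret prob_space "PiM UNIV \<rho>" by (intro prob_space_PiM \<rho>)
  interpret PP: pair_sigma_finite "PiM UNIV \<rho>" "PiM UNIV \<rho>" ..
  have sPP: "sigma_finite_measure (PiM UNIV \<rho> \<Otimes>\<^sub>M PiM UNIV \<rho>)" ..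
  have sets_\<rho> [measurable_cong]: "sets (PiM UNIV \<rho>) = sets (PiM UNIV (\<lambda>_. borel))" "sets (\<rho> k) = sets borel" for k
    by (auto intro!: sets_PiM_cong simp: \<rho>)
  have [simp]: "space (\<rho> k) = UNIV" for k using sets_eq_imp_space_eq[OF \<rho>(2)[of k]] by simp
  show c: "c (x, a, b) k0 = x" "c (x, a, b) \<circ> f = a" "c (x, a, b) \<circ> g = b" for x a b
    using part f g by (auto simp: c_def fun_eq_iff)
  have c_app: "c p k0 = fst p" "c p (f k) = fst (snd p) k" "c p (g k) = snd (snd p) k" for p k
    using c[of "fst p" "fst (snd p)" "snd (snd p)"] by (auto simp: fun_eq_iff)
  show cm [measurable]: "c \<in> measurable (\<rho> k0 \<Otimes>\<^sub>M PiM UNIV \<rho> \<Otimes>\<^sub>M PiM UNIV \<rho>) (PiM UNIV (\<lambda>_. borel))"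
  proof (rule measurable_PiM_UNIV_borelI)
    fix k
    consider "k = k0" | i where "k = f i" | i where "k = g i" using part(4) by blast
    then show "(\<lambda>x. c x k) \<in> borel_measurable (\<rho> k0 \<Otimes>\<^sub>M PiM UNIV \<rho> \<Otimes>\<^sub>M PiM UNIV \<rho>)"
      by cases (simp_all add: c_app)
  qed
  show "distr (\<rho> k0 \<Otimes>\<^sub>M PiM UNIV \<rho> \<Otimes>\<^sub>M PiM UNIV \<rho>) (PiM UNIV (\<lambda>_. borel)) c = PiM UNIV \<rho>" (is "?D = _")
  proof (rule PiM_eqI_cylinder[OF \<rho>])
    fix J :: "'i set" and A :: "'i \<Rightarrow> 'a set" assume J: "finite J" and A: "\<And>k. A k \<in> sets (borel :: 'a measure)"
    note [measurable] = A
    have cyl: "{z. \<forall>k\<in>K. z k \<in> A (h k)} \<in> sets (PiM UNIV (\<lambda>_. borel))" if [simp]: "finite K" for K h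
    proof -
      have "Measurable.pred (PiM UNIV (\<lambda>_. borel)) (\<lambda>z. \<forall>k\<in>K. z k \<in> A (h k))" by measurable
      then show ?thesis by (simp add: pred_def space_PiM)
    qed
    have fin: "finite (f -` J)" "finite (g -` J)" using J f(1) g(1) by (auto intro: finite_vimageI)
    \<comment> \<open>An index outside \<open>J\<close> is unconstrained, which \<open>UNIV\<close>
      expresses with total mass 1; the preimage of the cylinder is then a rectangle in the three
      factors.\<close>
    let ?S = "if k0 \<in> J then A k0 else UNIV"
    let ?C = "\<lambda>h. {z. \<forall>k\<in>h -` J. z k \<in> A (h k)}"
    have iff: "(\<forall>k\<in>J. c p k \<in> A k) \<longleftrightarrow> fst p \<in> ?S \<and> fst (snd p) \<in> ?C f \<and> snd (snd p) \<in> ?C g" (is "?L p \<longleftrightarrow> ?R p") for p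
    proof
      assume L: "?L p"
      show "?R p" using L c_app[of p] by (auto split: if_splits)
    next
      assume R: "?R p"
      show "?L p"
      proof
        fix k assume k: "k \<in> J"
        consider "k = k0" | i where "k = f i" | i where "k = g i" using part(4) by blast
        then show "c p k \<in> A k" using R k by cases (auto simp: c_app)
      qed
    qed
    have vimage: "c -` {z. \<forall>k\<in>J. z k \<in> A k} \<inter> space (\<rho> k0 \<Otimes>\<^sub>M PiM UNIV \<rho> \<Otimes>\<^sub>M PiM UNIV \<rho>)
        = ?S \<times> ?C f \<times> ?C g"
    proof (rule set_eqI)
      fix p
      have "p \<in> space (\<rho> k0 \<Otimes>\<^sub>M PiM UNIV \<rho> \<Otimes>\<^sub>M PiM UNIV \<rho>)"
        by (simp add: space_pair_measure space_PiM mem_Times_iff)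
      then show "p \<in> c -` {z. \<forall>k\<in>J. z k \<in> A k} \<inter> space (\<rho> k0 \<Otimes>\<^sub>M PiM UNIV \<rho> \<Otimes>\<^sub>M PiM UNIV \<rho>)
          \<longleftrightarrow> p \<in> ?S \<times> ?C f \<times> ?C g"
        by (simp only: Int_iff vimage_eq mem_Collect_eq iff mem_Times_iff simp_thms)
    qed
    have S: "?S \<in> sets borel" by simp
    have "emeasure ?D {z. \<forall>k\<in>J. z k \<in> A k} = emeasure (\<rho> k0 \<Otimes>\<^sub>M PiM UNIV \<rho> \<Otimes>\<^sub>M PiM UNIV \<rho>) (?S \<times> ?C f \<times> ?C g)"
      using cyl[OF J, of "\<lambda>k. k"] by (subst emeasure_distr) (simp_all only: vimage cm)
    also have "\<dots> = emeasure (\<rho> k0) ?S * emeasure (PiM UNIV \<rho> \<Otimes>\<^sub>M PiM UNIV \<rho>) (?C f \<times> ?C g)"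
      using cyl[OF fin(1), of f] cyl[OF fin(2), of g] S
      by (intro sigma_finite_measure.emeasure_pair_measure_Times[OF sPP] pair_measureI)
         (simp_all only: sets_\<rho>)
    also have "\<dots> = emeasure (\<rho> k0) ?S * (emeasure (PiM UNIV \<rho>) (?C f) * emeasure (PiM UNIV \<rho>) (?C g))"
      using cyl[OF fin(1), of f] cyl[OF fin(2), of g]
      by (subst emeasure_pair_measure_Times) (simp_all only: sets_\<rho>)
    also have "\<dots> = (\<Prod>k\<in>J \<inter> {k0}. emeasure (\<rho> k) (A k)) *
        ((\<Prod>k\<in>J \<inter> range f. emeasure (\<rho> k) (A k)) * (\<Prod>k\<in>J \<inter> range g. emeasure (\<rho> k) (A k)))"
    proof -
      have pr: "emeasure (PiM UNIV \<rho>) (?C h) = (\<Prod>k\<in>J \<inter> range h. emeasure (\<rho> k) (A k))"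
        if h: "inj h" "\<And>k. \<rho> (h k) = \<rho> k" for h
      proof -
        have inj: "inj_on h (h -` J)" using h(1) by (rule inj_on_subset) simp
        have "emeasure (PiM UNIV \<rho>) (?C h) = (\<Prod>k\<in>h -` J. emeasure (\<rho> k) (A (h k)))"
          using A J h(1) by (intro emeasure_PiM_cylinder[OF \<rho>] finite_vimageI) auto
        also have "\<dots> = (\<Prod>k\<in>h ` (h -` J). emeasure (\<rho> k) (A k))"
          by (subst prod.reindex[OF inj]) (simp add: h(2))
        finally show ?thesis by (simp only: image_vimage_eq)
      qed
      have "emeasure (\<rho> k0) ?S = (\<Prod>k\<in>J \<inter> {k0}. emeasure (\<rho> k) (A k))"
        using prob_space.emeasure_space_1[OF \<rho>(1), of k0] by simp
      then show ?thesis by (simp only: pr[OF f] pr[OF g])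
    qed
    also have "\<dots> = (\<Prod>k\<in>J \<inter> {k0} \<union> (J \<inter> range f \<union> J \<inter> range g). emeasure (\<rho> k) (A k))"
    proof -
      have "J \<inter> range f \<inter> (J \<inter> range g) = {}" "J \<inter> {k0} \<inter> (J \<inter> range f \<union> J \<inter> range g) = {}"
        using part(1-3) by blast+
      then show ?thesis using J by (simp only: prod.union_disjoint finite_Int finite_Un simp_thms)
    qed
    also have "J \<inter> {k0} \<union> (J \<inter> range f \<union> J \<inter> range g) = J"
      using part(4) by blast
    finally show "emeasure ?D {z. \<forall>k\<in>J. z k \<in> A k} = (\<Prod>k\<in>J. emeasure (\<rho> k) (A k))" .
  qed simp
qed

definition index_law :: "real measure \<Rightarrow> real \<Rightarrow> individual \<times> nat \<Rightarrow> ennreal measure" where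
  "index_law \<mu> \<delta> = (\<lambda>(u, j). if j = 0 then distr \<mu> borel ennreal else waiting_time_law \<delta>)"

definition config_law :: "real measure \<Rightarrow> real \<Rightarrow> config measure" where
  "config_law \<mu> \<delta> = PiM UNIV (index_law \<mu> \<delta>)"

lemma sets_waiting_time_law [simp, measurable_cong]: "sets (waiting_time_law \<delta>) = sets borel"
  by (simp add: waiting_time_law_def)

lemma prob_space_waiting_time_law:
  assumes "0 \<le> \<delta>"
  shows "prob_space (waiting_time_law \<delta>)"
proof (cases "\<delta> = 0")
  case False
  with assms interpret prob_space "density lborel (\<lambda>x. ennreal (exponential_density \<delta> x))"
    by (intro prob_space_exponential_density) simp
  show ?thesis using False by (simp add: waiting_time_law_def prob_space_distr)
qed (simp add: waiting_time_law_def prob_space_return)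

context
  fixes \<mu> :: "real measure" and \<delta> :: real
  assumes \<mu>: "prob_space \<mu>" "sets \<mu> = sets borel" and \<delta>: "0 \<le> \<delta>"
begin

lemma prob_space_index_law: "prob_space (index_law \<mu> \<delta> k)"
  using \<mu> by (auto simp: index_law_def prob_space_waiting_time_law[OF \<delta>] split: prod.split
     intro!: prob_space.prob_space_distr)

lemma sets_index_law: "sets (index_law \<mu> \<delta> k) = sets borel"
  by (auto simp: index_law_def split: prod.split)

lemma prob_space_config_law: "prob_space (config_law \<mu> \<delta>)"
  unfolding config_law_def by (intro prob_space_PiM prob_space_index_law)

lemma sets_config_law: "sets (config_law \<mu> \<delta>) = sets (PiM UNIV (\<lambda>_. borel))"
  unfolding config_law_def by (intro sets_PiM_cong sets_index_law) simp

end

section \<open>From the given probability space to the product law of configurations\<close>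

context splitting_tree
begin

lemma random_variables [measurable]:
  shows "life u \<in> borel_measurable M" "wait u i \<in> borel_measurable M"
    and "(\<lambda>\<omega> i. wait u i \<omega>) \<in> measurable M (PiM UNIV (\<lambda>_. borel))"
proof -
  have "(\<lambda>\<omega>. (life u \<omega>, \<lambda>i. wait u i \<omega>)) \<in> measurable M (borel \<Otimes>\<^sub>M PiM UNIV (\<lambda>_. borel))"
    using indep_individuals by (auto simp: indep_vars_def)
  from measurable_compose[OF this measurable_fst] measurable_compose[OF this measurable_snd]
  show "life u \<in> borel_measurable M" and *: "(\<lambda>\<omega> i. wait u i \<omega>) \<in> measurable M (PiM UNIV (\<lambda>_. borel))"
    by simp_all
  show "wait u i \<in> borel_measurable M"
    using measurable_compose[OF * measurable_component_singleton[of i]] by simp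
qed

definition config :: "'w \<Rightarrow> config" where
  "config \<omega> = (\<lambda>(u, j). case j of 0 \<Rightarrow> ennreal (life u \<omega>) | Suc i \<Rightarrow> wait u i \<omega>)"

lemma measurable_config_of [measurable]: "config \<in> measurable M (PiM UNIV (\<lambda>_. borel))"
proof (rule measurable_PiM_UNIV_borelI)
  fix k :: "individual \<times> nat"
  obtain u j where "k = (u, j)" by force
  then show "(\<lambda>\<omega>. config \<omega> k) \<in> borel_measurable M"
    by (cases j) (simp_all add: config_def)
qed

lemma life_law: "prob_space life_law" "sets life_law = sets borel"
  unfolding life_distr[symmetric, of "[]"] by (auto intro!: prob_space_distr)

lemma distr_waits: "distr M (PiM UNIV (\<lambda>_. borel)) (\<lambda>\<omega> i. wait u i \<omega>) = PiM UNIV (\<lambda>_. waiting_time_law \<delta>)"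
proof -
  have "indep_vars (\<lambda>_. borel) (wait u) UNIV" and d: "\<And>i. distr M borel (wait u i) = waiting_time_law \<delta>"
    using wait_poisson[of u] by (auto simp: poisson_waiting_times_def)
  then have "distr M (PiM UNIV (\<lambda>_. borel)) (\<lambda>\<omega>. \<lambda>i\<in>UNIV. wait u i \<omega>) = PiM UNIV (\<lambda>i. distr M borel (wait u i))"
    by (subst (asm) indep_vars_iff_distr_eq_PiM) auto
  then show ?thesis by (simp add: d restrict_def)
qed

lemma emeasure_individual:
  assumes "A \<in> sets borel" and "\<And>i. B i \<in> sets borel"
  shows "emeasure M {\<omega>\<in>space M. life u \<omega> \<in> A \<and> (\<forall>i\<in>{..<n}. wait u i \<omega> \<in> B i)}
    = emeasure life_law A * (\<Prod>i<n. emeasure (waiting_time_law \<delta>) (B i))"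
proof -
  note [measurable] = assms
  interpret W: prob_space "waiting_time_law \<delta>"
    using wait_poisson[of u] unfolding poisson_waiting_times_def by (metis prob_space_distr random_variables(2))
  interpret WP: prob_space "PiM UNIV (\<lambda>_::nat. waiting_time_law \<delta>)"
    by (intro prob_space_PiM) unfold_locales
  have C: "{v. \<forall>i\<in>{..<n}. v i \<in> B i} \<in> sets (PiM UNIV (\<lambda>_. borel))"
  proof -
    have "Measurable.pred (PiM UNIV (\<lambda>_. borel)) (\<lambda>v. \<forall>i\<in>{..<n}. v i \<in> B i)" by measurable
    then show ?thesis by (simp add: pred_def space_PiM)
  qed
  let ?R = "A \<times> {v. \<forall>i\<in>{..<n}. v i \<in> B i}"
  have "emeasure M {\<omega>\<in>space M. life u \<omega> \<in> A \<and> (\<forall>i\<in>{..<n}. wait u i \<omega> \<in> B i)}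
    = emeasure (distr M (borel \<Otimes>\<^sub>M PiM UNIV (\<lambda>_. borel)) (\<lambda>\<omega>. (life u \<omega>, \<lambda>i. wait u i \<omega>))) ?R"
    using C by (subst emeasure_distr) (auto intro!: arg_cong[where f="emeasure M"])
  also have "\<dots> = emeasure (life_law \<Otimes>\<^sub>M PiM UNIV (\<lambda>_. waiting_time_law \<delta>)) ?R"
    by (simp only: indep_life_wait life_distr distr_waits)
  also have "\<dots> = emeasure life_law A * emeasure (PiM UNIV (\<lambda>_. waiting_time_law \<delta>)) {v. \<forall>i\<in>{..<n}. v i \<in> B i}"
  proof (rule WP.emeasure_pair_measure_Times)
    have "sets (PiM UNIV (\<lambda>_::nat. waiting_time_law \<delta>)) = sets (PiM UNIV (\<lambda>_. borel))"
      by (intro sets_PiM_cong) auto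
    with C show "{v. \<forall>i\<in>{..<n}. v i \<in> B i} \<in> sets (PiM UNIV (\<lambda>_. waiting_time_law \<delta>))" by simp
  qed (simp add: life_law)
  also have "emeasure (PiM UNIV (\<lambda>_::nat. waiting_time_law \<delta>)) {v. \<forall>i\<in>{..<n}. v i \<in> B i} =
      (\<Prod>i<n. emeasure (waiting_time_law \<delta>) (B i))"
    using assms by (intro emeasure_PiM_cylinder) (auto simp: W.prob_space_axioms)
  finally show ?thesis .
qed

text \<open>Independence of the individuals, of life and births within one individual, and of the
  waiting times are three separate assumptions. They merge into one product law when tested on a
  full rectangle \<open>U \<times> {..n}\<close> of coordinates, which factors first over the
  individuals and then within each.\<close>

lemma distr_config:
  assumes "0 \<le> \<delta>"
  shows "distr M (PiM UNIV (\<lambda>_. borel)) config = config_law life_law \<delta>"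
  unfolding config_law_def
proof (rule PiM_eqI_cylinder)
  fix J :: "(individual \<times> nat) set" and A :: "individual \<times> nat \<Rightarrow> ennreal set"
  assume J: "finite J" and A [measurable]: "\<And>k. A k \<in> sets borel"
  define U where "U = fst ` J"
  have U: "finite U" using J by (simp add: U_def)
  obtain n where n: "snd ` J \<subseteq> {..n}"
    using finite_nat_set_iff_bounded_le[of "snd ` J"] J by auto
  \<comment> \<open>Padding with \<open>UNIV\<close> fills \<open>J\<close> up to a rectangle
    without changing the product, since every marginal has mass 1.\<close>
  define A' where "A' k = (if k \<in> J then A k else UNIV)" for k
  have A' [measurable]: "A' k \<in> sets borel" for k by (simp add: A'_def)
  have JU: "J \<subseteq> U \<times> {..n}" using n by (force simp: U_def)
  define B where "B u = {x. ennreal x \<in> A' (u, 0)} \<times> {v. \<forall>i\<in>{..<n}. v i \<in> A' (u, Suc i)}" for u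
  define X where "X u \<omega> = (life u \<omega>, \<lambda>i. wait u i \<omega>)" for u \<omega>
  have ennA: "{x. ennreal x \<in> A' k} \<in> sets borel" for k
    using measurable_sets[OF measurable_ennreal A'[of k]] by (simp add: vimage_def)
  have Bs: "B u \<in> sets (borel \<Otimes>\<^sub>M PiM UNIV (\<lambda>_. borel))" for u
    unfolding B_def
  proof (rule pair_measureI[OF ennA])
    have "Measurable.pred (PiM UNIV (\<lambda>_. borel)) (\<lambda>v. \<forall>i\<in>{..<n}. v i \<in> A' (u, Suc i))" by measurable
    then show "{v. \<forall>i\<in>{..<n}. v i \<in> A' (u, Suc i)} \<in> sets (PiM UNIV (\<lambda>_. borel))"
      by (simp add: pred_def space_PiM)
  qed
  have le_n: "(\<forall>j\<in>{..n}. P j) \<longleftrightarrow> P 0 \<and> (\<forall>i\<in>{..<n}. P (Suc i))" for P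
    by (simp add: lessThan_Suc_eq_insert_0 flip: lessThan_Suc_atMost)
  have in_B: "X u \<omega> \<in> B u \<longleftrightarrow> (\<forall>j\<in>{..n}. config \<omega> (u, j) \<in> A' (u, j))" for u \<omega>
    unfolding le_n by (simp add: X_def B_def config_def)
  have P: "emeasure M (X u -` B u \<inter> space M) = (\<Prod>j\<le>n. emeasure (index_law life_law \<delta> (u, j)) (A' (u, j)))" for u
  proof -
    have "emeasure M (X u -` B u \<inter> space M) =
        emeasure M {\<omega>\<in>space M. life u \<omega> \<in> {x. ennreal x \<in> A' (u, 0)} \<and> (\<forall>i\<in>{..<n}. wait u i \<omega> \<in> A' (u, Suc i))}"
      by (rule arg_cong[where f="emeasure M"]) (auto simp: X_def B_def)
    also have "\<dots> = emeasure life_law {x. ennreal x \<in> A' (u, 0)} * (\<Prod>i<n. emeasure (waiting_time_law \<delta>) (A' (u, Suc i)))"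
      by (rule emeasure_individual[OF ennA A'])
    also have "emeasure life_law {x. ennreal x \<in> A' (u, 0)} = emeasure (index_law life_law \<delta> (u, 0)) (A' (u, 0))"
    proof -
      have "ennreal \<in> borel_measurable life_law"
        by (simp add: measurable_cong_sets[OF life_law(2) refl])
      then show ?thesis
        using sets_eq_imp_space_eq[OF life_law(2)] by (simp add: index_law_def emeasure_distr vimage_def)
    qed
    finally show ?thesis
      by (simp add: prod.atMost_shift index_law_def)
  qed
  have eq: "config -` {z. \<forall>k\<in>J. z k \<in> A k} \<inter> space M = (\<Inter>u\<in>U. X u -` B u \<inter> space M)" if "U \<noteq> {}"
  proof -
    have "(\<forall>k\<in>J. config \<omega> k \<in> A k) \<longleftrightarrow> (\<forall>u\<in>U. \<forall>j\<in>{..n}. config \<omega> (u, j) \<in> A' (u, j))" for \<omega>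
      using JU by (auto simp: A'_def)
    then show ?thesis using that by (auto simp: in_B)
  qed
  have M: "emeasure M (config -` {z. \<forall>k\<in>J. z k \<in> A k} \<inter> space M) = (\<Prod>u\<in>U. emeasure M (X u -` B u \<inter> space M))"
  \<comment> \<open>Independence speaks of nonempty index sets; for \<open>U = {}\<close> both sides
    are 1.\<close>
  proof (cases "U = {}")
    case True
    then show ?thesis by (simp add: U_def emeasure_space_1)
  next
    case False
    have "indep_vars (\<lambda>_. borel \<Otimes>\<^sub>M PiM UNIV (\<lambda>_. borel)) X UNIV"
      using indep_individuals by (simp add: X_def[abs_def])
    from indep_varsD[OF this False U _ Bs] show ?thesis
      unfolding eq[OF False] by (simp add: emeasure_eq_measure prod_ennreal)
  qed
  have J_sets: "{z. \<forall>k\<in>J. z k \<in> A k} \<in> sets (PiM UNIV (\<lambda>_. borel))"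
  proof -
    have "Measurable.pred (PiM UNIV (\<lambda>_. borel)) (\<lambda>z. \<forall>k\<in>J. z k \<in> A k)" using J by measurable
    then show ?thesis by (simp add: pred_def space_PiM)
  qed
  have "emeasure (distr M (PiM UNIV (\<lambda>_. borel)) config) {z. \<forall>k\<in>J. z k \<in> A k}
    = (\<Prod>u\<in>U. \<Prod>j\<le>n. emeasure (index_law life_law \<delta> (u, j)) (A' (u, j)))"
    by (simp only: emeasure_distr[OF measurable_config_of J_sets] M P)
  also have "\<dots> = (\<Prod>k\<in>U \<times> {..n}. emeasure (index_law life_law \<delta> k) (A' k))"
    by (simp add: prod.cartesian_product)
  also have "\<dots> = (\<Prod>k\<in>J. emeasure (index_law life_law \<delta> k) (A' k))"
  proof (rule prod.mono_neutral_right)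
    show "\<forall>k\<in>U \<times> {..n} - J. emeasure (index_law life_law \<delta> k) (A' k) = 1"
      using prob_space.emeasure_space_1[OF prob_space_index_law[OF life_law assms]]
        sets_eq_imp_space_eq[OF sets_index_law[OF life_law assms]] by (simp add: A'_def)
  qed (use U JU in auto)
  also have "\<dots> = (\<Prod>k\<in>J. emeasure (index_law life_law \<delta> k) (A k))"
    by (simp add: A'_def)
  finally show "emeasure (distr M (PiM UNIV (\<lambda>_. borel)) config) {z. \<forall>k\<in>J. z k \<in> A k}
    = (\<Prod>k\<in>J. emeasure (index_law life_law \<delta> k) (A k))" .
qed (simp_all only: prob_space_index_law[OF life_law assms] sets_index_law[OF life_law assms] sets_distr)

end

section \<open>Generating functions\<close>

text \<open>For \<open>0 < s < 1\<close> the value 0 at infinity is the limit of the powers. It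
  keeps sums going to products without exception, and infinite populations drop out of the
  generating function.\<close>

definition pop_power :: "real \<Rightarrow> ennreal \<Rightarrow> ennreal" where
  "pop_power s x = (if x = \<infinity> then 0 else ennreal (s powr enn2real x))"

lemma pop_power_add: "0 < s \<Longrightarrow> pop_power s (x + y) = pop_power s x * pop_power s y"
  by (cases x; cases y) (auto simp: pop_power_def powr_add ennreal_mult simp flip: ennreal_plus)

lemma pop_power_le_1: "0 < s \<Longrightarrow> s < 1 \<Longrightarrow> pop_power s x \<le> 1"
  by (auto simp: pop_power_def intro!: powr_le1)

lemma measurable_pop_power [measurable]: "pop_power s \<in> borel_measurable borel"
  unfolding pop_power_def by measurable

locale life_tree =
  fixes \<mu> :: "real measure" and \<delta> :: real
  assumes prob_life: "prob_space \<mu>" and sets_life [measurable_cong]: "sets \<mu> = sets borel"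
    and life_pos: "AE r in \<mu>. 0 < r" and life_mean: "(\<integral>\<^sup>+r. ennreal r \<partial>\<mu>) = 1"
    and rate_nonneg: "0 \<le> \<delta>"
begin

sublocale life: prob_space \<mu> by (rule prob_life)

abbreviation "L \<equiv> config_law \<mu> \<delta>"

sublocale L: prob_space L
  by (intro prob_space_config_law prob_life sets_life rate_nonneg)

lemmas sets_L [measurable_cong] = sets_config_law[OF prob_life sets_life rate_nonneg]

lemma space_life [simp]: "space \<mu> = UNIV"
  using sets_eq_imp_space_eq[OF sets_life] by simp

lemma space_L [simp]: "space L = UNIV"
  using sets_eq_imp_space_eq[OF sets_L] by (simp add: space_PiM)

lemma ennreal_measurable_life [measurable]: "ennreal \<in> borel_measurable \<mu>"
  by (simp add: measurable_cong_sets[OF sets_life refl])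

text \<open>A fixed life \<open>r\<close> is needed to close the recursion: after the first birth
  the remaining life of the ancestor is \<open>r - x\<close>, which does not have the law
  \<open>\<mu>\<close>.\<close>

definition \<psi> :: "real \<Rightarrow> real \<Rightarrow> real \<Rightarrow> ennreal" where
  "\<psi> s r t = (\<integral>\<^sup>+z. pop_power s (pop_root r z t) \<partial>L)"

definition G :: "real \<Rightarrow> real \<Rightarrow> ennreal" where
  "G s t = (\<integral>\<^sup>+z. pop_power s (pop_root (config_life z []) z t) \<partial>L)"

lemma measurable_\<psi> [measurable (raw)]:
  assumes [measurable]: "f \<in> borel_measurable M" "h \<in> borel_measurable M"
  shows "(\<lambda>x. \<psi> s (f x) (h x)) \<in> borel_measurable M"
  unfolding \<psi>_def by measurable

lemma measurable_G [measurable (raw)]: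
  assumes [measurable]: "h \<in> borel_measurable M"
  shows "(\<lambda>x. G s (h x)) \<in> borel_measurable M"
  unfolding G_def by measurable

lemma \<psi>_le_1: "0 < s \<Longrightarrow> s < 1 \<Longrightarrow> \<psi> s r t \<le> 1"
  unfolding \<psi>_def
  using nn_integral_mono[of L "\<lambda>z. pop_power s (pop_root r z t)" "\<lambda>_. 1"] by (simp add: pop_power_le_1 L.emeasure_space_1[simplified])

lemma G_le_1: "0 < s \<Longrightarrow> s < 1 \<Longrightarrow> G s t \<le> 1"
  unfolding G_def
  using nn_integral_mono[of L "\<lambda>z. pop_power s (pop_root (config_life z []) z t)" "\<lambda>_. 1"] by (simp add: pop_power_le_1 L.emeasure_space_1[simplified])

text \<open>With \<open>r\<close> fixed, \<open>pop_root r z t\<close> is constant in the coordinate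
  \<open>([], 0)\<close>. Resampling this coordinate independently therefore turns the expectation
  into a mixture of \<open>\<psi>\<close> over \<open>\<mu>\<close>.\<close>

lemma G_eq_nn_integral_\<psi>: "G s t = (\<integral>\<^sup>+r. \<psi> s r t \<partial>\<mu>)"
proof -
  let ?k = "([], 0) :: individual \<times> nat"
  let ?N = "distr \<mu> borel ennreal"
  let ?F = "\<lambda>z. pop_power s (pop_root (config_life z []) z t)"
  have k: "index_law \<mu> \<delta> ?k = ?N" by (simp add: index_law_def)
  have [measurable]: "(\<lambda>(x, z). z(?k := x)) \<in> measurable (?N \<Otimes>\<^sub>M L) (PiM UNIV (\<lambda>_. borel))"
    by (rule measurable_PiM_UNIV_borelI) (simp add: split_beta' fun_upd_def; measurable)
  have *: "config_life (z(?k := x)) [] = enn2real x" "pop_root r (z(?k := x)) t = pop_root r z t" for r x z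
  proof -
    have "(config_life (z(?k := x)))([] := r) = (config_life z)([] := r)"
      "config_wait (z(?k := x)) = config_wait z"
      by (auto simp: fun_eq_iff config_life_def config_wait_def)
    then show "pop_root r (z(?k := x)) t = pop_root r z t" by (simp only: pop_root_def)
  qed (simp add: config_life_def)
  have L: "L = distr (?N \<Otimes>\<^sub>M L) (PiM UNIV (\<lambda>_. borel)) (\<lambda>(x, z). z(?k := x))"
    using distr_PiM_update[of "index_law \<mu> \<delta>" ?k, OF prob_space_index_law[OF prob_life sets_life rate_nonneg]
       sets_index_law[OF prob_life sets_life rate_nonneg]] unfolding k config_law_def by simp
  have "G s t = (\<integral>\<^sup>+p. ?F p \<partial>distr (?N \<Otimes>\<^sub>M L) (PiM UNIV (\<lambda>_. borel)) (\<lambda>(x, z). z(?k := x)))"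
    unfolding G_def using L by simp
  also have "\<dots> = (\<integral>\<^sup>+p. pop_power s (pop_root (enn2real (fst p)) (snd p) t) \<partial>(?N \<Otimes>\<^sub>M L))"
    by (subst nn_integral_distr) (simp_all add: split_beta' *)
  also have "\<dots> = (\<integral>\<^sup>+x. \<psi> s (enn2real x) t \<partial>?N)"
    unfolding \<psi>_def by (subst L.nn_integral_fst[symmetric]) simp_all
  also have "\<dots> = (\<integral>\<^sup>+r. \<psi> s (enn2real (ennreal r)) t \<partial>\<mu>)"
    by (subst nn_integral_distr) simp_all
  \<comment> \<open>\<open>enn2real (ennreal r) = r\<close> requires \<open>r \<ge> 0\<close>, which
    holds almost everywhere.\<close>
  also have "\<dots> = (\<integral>\<^sup>+r. \<psi> s r t \<partial>\<mu>)"
    using life_pos by (intro nn_integral_cong_AE) auto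
  finally show ?thesis .
qed

text \<open>Conditioning on the first waiting time \<open>x\<close>: a birth within the life and up
  to \<open>t\<close> splits the population into two independent ones, so the expectation becomes a
  product; otherwise only the ancestor can be alive. An infinite \<open>x\<close>, as for
  \<open>\<delta> = 0\<close>, falls into the second case.\<close>

lemma \<psi>_first_birth:
  assumes "0 < s" "0 \<le> t"
  shows "\<psi> s r t = (\<integral>\<^sup>+x. (if x < ennreal r \<and> x \<le> ennreal t
      then G s (t - enn2real x) * \<psi> s (r - enn2real x) (t - enn2real x) else ennreal (s powr of_bool (t < r)))
      \<partial>waiting_time_law \<delta>)"
proof -
  let ?k = "([], Suc 0) :: individual \<times> nat"
  let ?N = "waiting_time_law \<delta>"
  define c where "c = (\<lambda>(x::ennreal, a::config, b::config) k. if k = ?k then x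
      else if k \<in> range child_index then a (inv child_index k) else b (inv rest_index k))"
  have k: "index_law \<mu> \<delta> ?k = ?N" by (simp add: index_law_def)
  have ci: "index_law \<mu> \<delta> (child_index i) = index_law \<mu> \<delta> i" for i
    by (auto simp: index_law_def child_index_def split: prod.splits)
  have ri: "index_law \<mu> \<delta> (rest_index i) = index_law \<mu> \<delta> i" for i
    by (auto simp: index_law_def rest_index_def split: prod.splits)
  note split = distr_PiM_split[of "index_law \<mu> \<delta>" child_index rest_index ?k,
      OF prob_space_index_law[OF prob_life sets_life rate_nonneg]
       sets_index_law[OF prob_life sets_life rate_nonneg] inj_child_index ci inj_rest_index ri
       index_partition, folded c_def config_law_def, unfolded k]
  note [measurable] = split(2)
  have cs: "c (x, a, b) ([], Suc 0) = x" "c (x, a, b) \<circ> child_index = a" "c (x, a, b) \<circ> rest_index = b" for x a b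
    by (rule split(3-5))+
  have F: "pop_power s (pop_root r (c (x, a, b)) t) = (if x < ennreal r \<and> x \<le> ennreal t
      then pop_power s (pop_root (config_life a []) a (t - enn2real x)) * pop_power s (pop_root (r - enn2real x) b (t - enn2real x))
      else ennreal (s powr of_bool (t < r)))" for x a b
  proof (cases "x < ennreal r \<and> x \<le> ennreal t")
    case True
    then obtain x' where x': "x = ennreal x'" "0 \<le> x'"
      by (metis enn2real_nonneg ennreal_enn2real less_top top.not_eq_extremum order.strict_trans2 top_greatest)
    with True assms have "x' < r" "x' \<le> t"
      by (auto simp: ennreal_less_iff)
    then show ?thesis
      using True x' pop_root_first_birth[of "c (x, a, b)" x' r t] \<open>0 < s\<close>
      by (simp add: cs pop_power_add)
  next
    case False
    then have "pop_root r (c (x, a, b)) t = of_bool (t < r)"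
      using assms by (intro pop_root_no_birth) (simp_all only: cs simp_thms)
    then show ?thesis
      by (subst if_not_P[OF False]) (simp add: pop_power_def)
  qed
  have "\<psi> s r t = (\<integral>\<^sup>+z. pop_power s (pop_root r z t) \<partial>distr (?N \<Otimes>\<^sub>M L \<Otimes>\<^sub>M L) (PiM UNIV (\<lambda>_. borel)) c)"
    unfolding \<psi>_def using split(1) by simp
  also have "\<dots> = (\<integral>\<^sup>+p. pop_power s (pop_root r (c p) t) \<partial>(?N \<Otimes>\<^sub>M L \<Otimes>\<^sub>M L))"
    by (subst nn_integral_distr) simp_all
  also have "\<dots> = (\<integral>\<^sup>+x. \<integral>\<^sup>+q. pop_power s (pop_root r (c (x, q)) t) \<partial>(L \<Otimes>\<^sub>M L) \<partial>?N)"
  proof -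
    interpret LL: pair_sigma_finite L L ..
    interpret LL: sigma_finite_measure "L \<Otimes>\<^sub>M L" ..
    show ?thesis by (subst LL.nn_integral_fst[symmetric]) simp_all
  qed
  also have "\<dots> = (\<integral>\<^sup>+x. \<integral>\<^sup>+a. \<integral>\<^sup>+b. pop_power s (pop_root r (c (x, a, b)) t) \<partial>L \<partial>L \<partial>?N)"
  proof (intro nn_integral_cong)
    fix x assume "x \<in> space ?N"
    then have [measurable]: "(\<lambda>q. c (x, q)) \<in> measurable (L \<Otimes>\<^sub>M L) (PiM UNIV (\<lambda>_. borel))"
      by (intro measurable_compose[OF measurable_Pair1' split(2)])
    show "(\<integral>\<^sup>+q. pop_power s (pop_root r (c (x, q)) t) \<partial>(L \<Otimes>\<^sub>M L)) = (\<integral>\<^sup>+a. \<integral>\<^sup>+b. pop_power s (pop_root r (c (x, a, b)) t) \<partial>L \<partial>L)"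
      by (subst L.nn_integral_fst[symmetric]) simp_all
  qed
  also have "\<dots> = (\<integral>\<^sup>+x. (if x < ennreal r \<and> x \<le> ennreal t
      then G s (t - enn2real x) * \<psi> s (r - enn2real x) (t - enn2real x) else ennreal (s powr of_bool (t < r)))
      \<partial>?N)"
  proof (intro nn_integral_cong)
    fix x
    show "(\<integral>\<^sup>+a. \<integral>\<^sup>+b. pop_power s (pop_root r (c (x, a, b)) t) \<partial>L \<partial>L) = (if x < ennreal r \<and> x \<le> ennreal t
      then G s (t - enn2real x) * \<psi> s (r - enn2real x) (t - enn2real x) else ennreal (s powr of_bool (t < r)))"
    proof (cases "x < ennreal r \<and> x \<le> ennreal t")
      case True
      then show ?thesis
        by (simp only: F if_P[OF True]) (simp add: G_def \<psi>_def nn_integral_cmult nn_integral_multc)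
    next
      case False
      then show ?thesis
        using L.emeasure_space_1 by (simp only: F if_not_P[OF False]) simp
    qed
  qed
  finally show ?thesis .
qed

definition g :: "real \<Rightarrow> real \<Rightarrow> real" where
  "g s t = enn2real (G s t)"

definition F :: "real \<Rightarrow> real \<Rightarrow> real" where
  "F s t = integral {0..t} (\<lambda>u. 1 - g s u)"

definition V :: "real \<Rightarrow> real \<Rightarrow> real" where
  "V s t = exp (\<delta> * F s t)"

definition life_tail :: "real \<Rightarrow> real" where
  "life_tail t = measure \<mu> {t<..}"

lemma measurable_g [measurable]: "g s \<in> borel_measurable borel"
  unfolding g_def by measurable

lemma g_nonneg [simp]: "0 \<le> g s t"
  by (simp add: g_def)

lemma measurable_life_tail [measurable]: "life_tail \<in> borel_measurable borel"
proof -
  have "mono (\<lambda>t. - life_tail t)"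
    unfolding life_tail_def by (intro monoI) (auto intro!: life.finite_measure_mono simp: sets_life)
  then have "(\<lambda>t. - life_tail t) \<in> borel_measurable borel"
    by (rule borel_measurable_mono)
  then show ?thesis by simp
qed

lemma life_tail_bounds [simp]: "0 \<le> life_tail t" "life_tail t \<le> 1"
  by (simp_all add: life_tail_def)

lemma life_tail_integrable [simp]: "life_tail integrable_on {a..b}"
  by (rule bounded_borel_integrable_on[where B=1]) auto

lemma life_tail_reflect_integrable [simp]: "(\<lambda>y. life_tail (t - y)) integrable_on {a..b}"
  by (rule bounded_borel_integrable_on[where B=1]) auto

section \<open>The generating function for a fixed life of the ancestor\<close>

context
  fixes s :: real
  assumes s: "0 < s" "s < 1"
begin

lemma G_eq: "G s t = ennreal (g s t)"
  using le_less_trans[OF G_le_1[OF s, of t] ennreal_one_less_top] by (simp add: g_def)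

lemma g_le_1 [simp]: "g s t \<le> 1"
  using G_le_1[OF s, of t] unfolding G_eq by simp

lemma \<psi>_eq: "\<psi> s r t = ennreal (enn2real (\<psi> s r t))"
  using le_less_trans[OF \<psi>_le_1[OF s, of r t] ennreal_one_less_top] by simp

lemma \<psi>_real_le_1: "enn2real (\<psi> s r t) \<le> 1"
  using enn2real_mono[OF \<psi>_le_1[OF s, of r t]] by simp

text \<open>A restart lowers \<open>r\<close> and \<open>t\<close> equally, so the recursion stays
  on the diagonal through \<open>(r0, t0)\<close>, where one coordinate is 0; thus \<open>y\<close>
  is the minimum of life and time. The power of \<open>s\<close> is constant along the diagonal, and
  \<open>exp (- y * \<delta>)\<close> is the probability of no birth up to \<open>y\<close>.\<close>

lemma \<psi>_diagonal_recursion: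
  assumes \<delta>: "0 < \<delta>" and r0: "0 \<le> r0" and t0: "0 \<le> t0" and 0: "r0 = 0 \<or> t0 = 0" and y: "0 \<le> y"
  defines "p \<equiv> \<lambda>y. enn2real (\<psi> s (r0 + y) (t0 + y))"
  shows "p y = integral {0..y} (\<lambda>x. \<delta> * exp (- x * \<delta>) * (g s (t0 + (y - x)) * p (y - x)))
     + s powr of_bool (t0 < r0) * exp (- y * \<delta>)"
proof -
  have [measurable]: "p \<in> borel_measurable borel" unfolding p_def by measurable
  have p: "0 \<le> p x" "p x \<le> 1" for x using \<psi>_real_le_1 by (simp_all add: p_def)
  define \<sigma> where "\<sigma> = s powr of_bool (t0 < r0)"
  have \<sigma>: "0 \<le> \<sigma>" by (simp add: \<sigma>_def)
  define H where "H x = (if x < ennreal (r0 + y) \<and> x \<le> ennreal (t0 + y)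
      then G s (t0 + y - enn2real x) * \<psi> s (r0 + y - enn2real x) (t0 + y - enn2real x)
      else ennreal \<sigma>)" for x
  have [measurable]: "H \<in> borel_measurable borel" unfolding H_def by measurable
  define h where "h x = \<delta> * exp (- x * \<delta>) * (g s (t0 + (y - x)) * p (y - x))" for x
  have [measurable]: "h \<in> borel_measurable borel" unfolding h_def by measurable
  have h: "0 \<le> h x" for x unfolding h_def using \<delta> p by simp
  have hB: "h x \<le> \<delta>" if "0 \<le> x" for x
  proof -
    have "\<delta> * exp (- x * \<delta>) * (g s (t0 + (y - x)) * p (y - x)) \<le> \<delta> * 1 * (1 * 1)"
      using p \<delta> that by (intro mult_mono) auto
    then show ?thesis by (simp add: h_def)
  qed
  have "\<psi> s (r0 + y) (t0 + y) = (\<integral>\<^sup>+x. H x \<partial>waiting_time_law \<delta>)"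
    using \<psi>_first_birth[OF s(1), of "t0 + y" "r0 + y"] y t0
    unfolding H_def \<sigma>_def by (simp only: add_less_cancel_right add_nonneg_nonneg)
  also have "\<dots> = (\<integral>\<^sup>+x. ennreal (exponential_density \<delta> x) * H (ennreal x) \<partial>lborel)"
    using \<delta> by (simp add: waiting_time_law_def nn_integral_distr nn_integral_density)
  also have "\<dots> = (\<integral>\<^sup>+x. ennreal (h x) * indicator {0..y} x + ennreal (\<sigma> * (\<delta> * exp (- x * \<delta>))) * indicator {y..} x \<partial>lborel)"
  proof (rule nn_integral_cong_AE)
    \<comment> \<open>At \<open>x = y\<close> the two indicators overlap; a single point is
      negligible.\<close>
    have "AE x in lborel. x \<noteq> y" by (rule AE_lborel_singleton)
    then show "AE x in lborel. ennreal (exponential_density \<delta> x) * H (ennreal x)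
       = ennreal (h x) * indicator {0..y} x + ennreal (\<sigma> * (\<delta> * exp (- x * \<delta>))) * indicator {y..} x"
    proof (eventually_elim)
      fix x assume "x \<noteq> y"
      then consider "x < 0" | "0 \<le> x" "x < y" | "0 \<le> x" "y < x" by linarith
      then show "ennreal (exponential_density \<delta> x) * H (ennreal x)
       = ennreal (h x) * indicator {0..y} x + ennreal (\<sigma> * (\<delta> * exp (- x * \<delta>))) * indicator {y..} x"
      proof cases
        case 1
        then show ?thesis using y by (simp add: exponential_density_def)
      next
        case 2
        have "ennreal x < ennreal (r0 + y) \<and> ennreal x \<le> ennreal (t0 + y)"
          using 2 r0 t0 by (auto simp: ennreal_less_iff simp del: ennreal_plus intro!: ennreal_leI)
        then have "H (ennreal x) = ennreal (g s (t0 + (y - x)) * p (y - x))"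
          using 2 \<psi>_eq[of "r0 + (y - x)" "t0 + (y - x)"] p
          by (simp add: H_def G_eq p_def ennreal_mult add_diff_eq)
        then show ?thesis
          using 2 \<delta> p by (simp add: exponential_density_def h_def ennreal_mult mult.assoc)
      next
        case 3
        \<comment> \<open>The fact named \<open>0\<close> is the assumption
          \<open>r0 = 0 \<or> t0 = 0\<close>: a first birth after \<open>y\<close> comes too late
          for the life or for the time \<open>t0 + y\<close>.\<close>
        have "\<not> (ennreal x < ennreal (r0 + y) \<and> ennreal x \<le> ennreal (t0 + y))"
          using 3 0 r0 t0 y by (auto simp: ennreal_less_iff)
        then have "H (ennreal x) = ennreal \<sigma>" unfolding H_def by (rule if_not_P)
        then show ?thesis
          using 3 \<delta> \<sigma> by (simp add: exponential_density_def ennreal_mult mult_ac)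
      qed
    qed
  qed
  also have "\<dots> = (\<integral>\<^sup>+x\<in>{0..y}. ennreal (h x) \<partial>lborel) + (\<integral>\<^sup>+x. ennreal (\<sigma> * (\<delta> * exp (- x * \<delta>))) * indicator {y..} x \<partial>lborel)"
    by (rule nn_integral_add) auto
  also have "(\<integral>\<^sup>+x\<in>{0..y}. ennreal (h x) \<partial>lborel) = ennreal (integral {0..y} h)"
    using h hB by (intro nn_integral_Icc_eq_integral[where B=\<delta>]) auto
  also have "(\<integral>\<^sup>+x. ennreal (\<sigma> * (\<delta> * exp (- x * \<delta>))) * indicator {y..} x \<partial>lborel) = ennreal (0 - (- \<sigma> * exp (- y * \<delta>)))"
  proof (rule nn_integral_FTC_atLeast)
    show "((\<lambda>x. - \<sigma> * exp (- x * \<delta>)) \<longlongrightarrow> 0) at_top"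
    proof -
      have "LIM x at_top. - x * \<delta> :> at_bot"
        using \<delta> by (auto simp: filterlim_uminus_at_bot intro!: filterlim_at_top_mult_tendsto_pos[OF tendsto_const] filterlim_ident)
      then have "((\<lambda>x. exp (- x * \<delta>)) \<longlongrightarrow> 0) at_top"
        by (rule filterlim_compose[OF exp_at_bot])
      then show ?thesis using tendsto_mult_right_zero by blast
    qed
  qed (use \<sigma> \<delta> in \<open>auto intro!: derivative_eq_intros\<close>)
  finally have "\<psi> s (r0 + y) (t0 + y) = ennreal (integral {0..y} h) + ennreal (\<sigma> * exp (- y * \<delta>))"
    by simp
  moreover have "0 \<le> integral {0..y} h"
    using h hB by (intro Henstock_Kurzweil_Integration.integral_nonneg bounded_borel_integrable_on[where B=\<delta>]) auto
  ultimately have "p y = integral {0..y} h + \<sigma> * exp (- y * \<delta>)"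
    using \<sigma> by (simp add: p_def del: ennreal_plus flip: ennreal_plus)
  then show ?thesis unfolding h_def \<sigma>_def .
qed

lemma one_minus_g_integrable: "(\<lambda>u. 1 - g s u) integrable_on {a..b}"
proof (rule bounded_borel_integrable_on[where B=1])
  show "\<bar>1 - g s x\<bar> \<le> 1" for x using g_le_1[of x] g_nonneg[of s x] by linarith
qed measurable

lemma F_diff:
  assumes "0 \<le> a" "a \<le> b"
  shows "F s b - F s a = integral {a..b} (\<lambda>u. 1 - g s u)"
  using Henstock_Kurzweil_Integration.integral_combine[OF assms one_minus_g_integrable] unfolding F_def by simp

text \<open>This is the generating functional of the Poisson births of the ancestor, each birth
  contributing \<open>g s\<close> of the time left. The factor \<open>exp (y * \<delta>)\<close> in
  \<open>k\<close> cancels the waiting-time density in the recursion and leaves a linear Volterra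
  equation with coefficient \<open>\<delta> * g s\<close>.\<close>

lemma \<psi>_explicit:
  assumes \<delta>: "0 < \<delta>" and "0 \<le> r" "0 \<le> t"
  shows "\<psi> s r t = ennreal (s powr of_bool (t < r) * exp (- \<delta> * (F s t - F s (t - min r t))))"
proof -
  define c where "c = min r t"
  define r0 where "r0 = r - c"
  define t0 where "t0 = t - c"
  have c: "0 \<le> c" "0 \<le> r0" "0 \<le> t0" "r0 = 0 \<or> t0 = 0" and rt: "r = r0 + c" "t = t0 + c"
    using assms by (auto simp: c_def r0_def t0_def)
  define p where "p y = enn2real (\<psi> s (r0 + y) (t0 + y))" for y
  have [measurable]: "p \<in> borel_measurable borel" unfolding p_def by measurable
  have p: "0 \<le> p x" "p x \<le> 1" for x using \<psi>_real_le_1 by (simp_all add: p_def)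
  define \<sigma> where "\<sigma> = s powr of_bool (t0 < r0)"
  define k where "k y = exp (y * \<delta>) * p y" for y
  have [measurable]: "k \<in> borel_measurable borel" unfolding k_def by measurable
  define h where "h y = \<delta> * g s (t0 + y)" for y
  have [measurable]: "h \<in> borel_measurable borel" unfolding h_def by measurable
  have "k c = \<sigma> * exp (integral {0..c} h)"
  proof (rule linear_Volterra_exp[where B=\<delta> and C="exp (c * \<delta>) * 1"])
    fix y assume y: "y \<in> {0..c}"
    show "\<bar>k y\<bar> \<le> exp (c * \<delta>) * 1"
      unfolding k_def abs_mult using y p \<delta> by (intro mult_mono) auto
    \<comment> \<open>\<open>q\<close> is the integrand in terms of \<open>z = y - x\<close>. The
      reflection turns the convolution into an integral from which
      \<open>exp (- y * \<delta>)\<close> can be taken out.\<close>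
    define q where "q z = \<delta> * exp (- (y - z) * \<delta>) * (g s (t0 + z) * p z)" for z
    have "p y = integral {0..y} (\<lambda>x. q (y - x)) + \<sigma> * exp (- y * \<delta>)"
      using \<psi>_diagonal_recursion[OF \<delta> c(2-4), of y] y by (simp add: p_def q_def \<sigma>_def)
    also have "integral {0..y} (\<lambda>x. q (y - x)) = integral {0..y} q"
      using integral_reflect_shift[of 0 y q y] by simp
    also have "integral {0..y} q = exp (- y * \<delta>) * integral {0..y} (\<lambda>x. h x * k x)"
    proof -
      have "q = (\<lambda>z. exp (- y * \<delta>) * (h z * k z))"
        by (auto simp: q_def h_def k_def fun_eq_iff exp_diff exp_minus left_diff_distrib field_simps)
      then show ?thesis by simp
    qed
    finally show "k y = \<sigma> + integral {0..y} (\<lambda>x. h x * k x)"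
      unfolding k_def by (simp add: distrib_left exp_minus field_simps)
  qed (use \<delta> c in \<open>auto simp: h_def\<close>)
  moreover have "integral {0..c} h = \<delta> * c - \<delta> * (F s t - F s t0)"
  proof -
    have "F s t - F s t0 = integral {t0..t0 + c} (\<lambda>u. 1 - g s u)"
      using F_diff[of t0 "t0 + c"] c by (simp add: rt)
    also have "\<dots> = integral {0..c} (\<lambda>y. 1 - g s (t0 + y))"
      using integral_shift_Icc_real[of 0 c "\<lambda>u. 1 - g s u" t0] by (simp add: o_def add.commute)
    also have "\<dots> = integral {0..c} (\<lambda>y. 1) - integral {0..c} (\<lambda>y. g s (t0 + y))"
      by (intro Henstock_Kurzweil_Integration.integral_diff bounded_borel_integrable_on[where B=1]) auto
    finally have "integral {0..c} (\<lambda>y. g s (t0 + y)) = c - (F s t - F s t0)" using c by simp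
    then show ?thesis unfolding h_def by (simp add: right_diff_distrib)
  qed
  ultimately have "exp (c * \<delta>) * p c = \<sigma> * (exp (c * \<delta>) * exp (- \<delta> * (F s t - F s t0)))"
    unfolding k_def by (simp add: mult_exp_exp algebra_simps)
  then have "p c = \<sigma> * exp (- \<delta> * (F s t - F s t0))" by simp
  then have "\<psi> s r t = ennreal (\<sigma> * exp (- \<delta> * (F s t - F s t0)))"
    using \<psi>_eq[of r t] by (simp add: p_def rt)
  moreover have "t0 < r0 \<longleftrightarrow> t < r" by (simp add: rt)
  ultimately show ?thesis by (simp add: \<sigma>_def t0_def c_def)
qed

end

section \<open>The linear renewal equation for \<open>V\<close>\<close>

context
  fixes s :: real
  assumes s: "0 < s" "s < 1"
begin

lemma one_minus_g_bounds: "0 \<le> 1 - g s u" "1 - g s u \<le> 1"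
  using g_le_1[OF s, of u] g_nonneg[of s u] by simp_all

lemma F_0 [simp]: "F s 0 = 0"
  by (simp add: F_def)

lemma F_mono: "0 \<le> a \<Longrightarrow> a \<le> b \<Longrightarrow> F s a \<le> F s b"
  using F_diff[OF s, of a b] integral_nonneg[OF one_minus_g_integrable[OF s], of a b] one_minus_g_bounds
  by simp

lemma F_nonneg: "0 \<le> F s t"
  using F_mono[of 0 t] by (cases "0 \<le> t") (auto simp: F_def)

lemma measurable_F [measurable]: "F s \<in> borel_measurable borel"
  unfolding F_def by (intro borel_measurable_integral_bounded) (auto intro!: exI[of _ 1] simp: abs_of_nonneg[OF one_minus_g_bounds(1)])

lemma measurable_V [measurable]: "V s \<in> borel_measurable borel"
  unfolding V_def by measurable

lemma V_mono: "0 \<le> a \<Longrightarrow> a \<le> b \<Longrightarrow> V s a \<le> V s b"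
  unfolding V_def using F_mono rate_nonneg by (simp add: mult_left_mono)

lemma V_ge_1: "1 \<le> V s t"
  unfolding V_def using F_nonneg[of t] rate_nonneg by simp

lemma V_nonneg: "0 \<le> V s t"
  unfolding V_def by simp

lemma V_mult_integrable:
  assumes [measurable]: "h \<in> borel_measurable borel" and h: "\<And>x. 0 \<le> h x" "\<And>x. h x \<le> 1"
  shows "(\<lambda>y. V s y * h y) integrable_on {0..t}"
proof (rule bounded_borel_integrable_on[where B="V s t * 1"])
  fix x assume "x \<in> {0..t}"
  then show "\<bar>V s x * h x\<bar> \<le> V s t * 1"
    unfolding abs_mult using V_mono[of x t] V_nonneg h by (intro mult_mono) auto
qed measurable

lemma V_integral:
  assumes "0 \<le> t"
  shows "V s t = 1 + \<delta> * integral {0..t} (\<lambda>y. V s y * (1 - g s y))"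
proof -
  have F: "integral {0..y} (\<lambda>u. \<delta> * (1 - g s u)) = \<delta> * F s y" for y
    by (simp add: F_def)
  have "exp (integral {0..t} (\<lambda>u. \<delta> * (1 - g s u))) =
     1 + integral {0..t} (\<lambda>y. \<delta> * (1 - g s y) * exp (integral {0..y} (\<lambda>u. \<delta> * (1 - g s u))))"
  proof (rule exp_integral_eq[where B=\<delta>])
    show "\<delta> * (1 - g s x) \<le> \<delta>" for x
      using mult_left_mono[OF one_minus_g_bounds(2)[of x] rate_nonneg] by simp
  qed (use assms rate_nonneg one_minus_g_bounds in auto)
  also have "(\<lambda>y. \<delta> * (1 - g s y) * exp (integral {0..y} (\<lambda>u. \<delta> * (1 - g s u)))) = (\<lambda>y. \<delta> * (V s y * (1 - g s y)))"
    unfolding F V_def by (simp add: mult_ac)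
  finally show ?thesis unfolding F V_def by simp
qed

text \<open>The factor \<open>V s t\<close> cancels \<open>exp (- \<delta> * F s t)\<close> in
  \<open>\<psi>_explicit\<close>. A life beyond \<open>t\<close> then leaves
  \<open>s * V s 0 = s\<close>, and a life \<open>r \<le> t\<close> leaves
  \<open>V s (t - r)\<close>, so the right side is linear in \<open>V s\<close>.\<close>

lemma V_times_g:
  assumes \<delta>: "0 < \<delta>" and t: "0 \<le> t"
  shows "ennreal (V s t * g s t) = ennreal (s * life_tail t) + (\<integral>\<^sup>+r. ennreal (V s (t - r)) * indicator {0<..t} r \<partial>\<mu>)"
proof -
  have "ennreal (V s t * g s t) = (\<integral>\<^sup>+r. ennreal (V s t) * \<psi> s r t \<partial>\<mu>)"
    by (simp add: nn_integral_cmult G_eq_nn_integral_\<psi>[symmetric] G_eq[OF s] ennreal_mult V_nonneg)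
  also have "\<dots> = (\<integral>\<^sup>+r. ennreal s * indicator {t<..} r + ennreal (V s (t - r)) * indicator {0<..t} r \<partial>\<mu>)"
  proof (rule nn_integral_cong_AE)
    show "AE r in \<mu>. ennreal (V s t) * \<psi> s r t = ennreal s * indicator {t<..} r + ennreal (V s (t - r)) * indicator {0<..t} r"
      using life_pos
    proof eventually_elim
      fix r :: real assume r: "0 < r"
      have *: "ennreal (V s t) * \<psi> s r t = ennreal (V s t * (s powr of_bool (t < r) * exp (- \<delta> * (F s t - F s (t - min r t)))))"
        using r t V_nonneg[of t] by (subst \<psi>_explicit[OF s \<delta>]) (simp_all add: ennreal_mult)
      show "ennreal (V s t) * \<psi> s r t = ennreal s * indicator {t<..} r + ennreal (V s (t - r)) * indicator {0<..t} r"
      proof (cases "t < r")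
        case True
        have "V s t * (s powr of_bool (t < r) * exp (- \<delta> * (F s t - F s (t - min r t)))) = s"
          using True s by (simp add: V_def exp_minus)
        with True show ?thesis unfolding * by simp
      next
        case False
        have "V s t * (s powr of_bool (t < r) * exp (- \<delta> * (F s t - F s (t - min r t)))) = V s (t - r)"
          using False s by (simp add: V_def mult_exp_exp right_diff_distrib)
        with False r show ?thesis unfolding * by simp
      qed
    qed
  qed
  also have "\<dots> = (\<integral>\<^sup>+r. ennreal s * indicator {t<..} r \<partial>\<mu>) + (\<integral>\<^sup>+r. ennreal (V s (t - r)) * indicator {0<..t} r \<partial>\<mu>)"
    by (rule nn_integral_add) auto
  also have "(\<integral>\<^sup>+r. ennreal s * indicator {t<..} r \<partial>\<mu>) = ennreal (s * life_tail t)"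
    using s by (subst nn_integral_cmult_indicator) (auto simp: life_tail_def life.emeasure_eq_measure ennreal_mult sets_life)
  finally show ?thesis .
qed

lemma emeasure_life_Ioc: "0 \<le> x \<Longrightarrow> emeasure \<mu> {0<..x} = ennreal (1 - life_tail x)"
proof -
  assume "0 \<le> x"
  have "emeasure \<mu> {0<..x} = emeasure \<mu> (space \<mu> - {x<..})"
    using life_pos by (intro emeasure_eq_AE) (auto simp: sets_life)
  also have "\<dots> = ennreal (1 - life_tail x)"
    unfolding life.emeasure_eq_measure life_tail_def by (subst life.prob_compl) (auto simp: sets_life)
  finally show ?thesis .
qed

text \<open>Tonelli with the shift \<open>u = r + y\<close>: for fixed \<open>y\<close> the
  admissible lives are those in \<open>{0<..t - y}\<close>, a set of mass
  \<open>1 - life_tail (t - y)\<close>.\<close>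

lemma nn_integral_V_convolution:
  assumes t: "0 \<le> t"
  shows "(\<integral>\<^sup>+u. (\<integral>\<^sup>+r. ennreal (V s (u - r)) * indicator {0<..u} r \<partial>\<mu>) * indicator {0..t} u \<partial>lborel)
    = ennreal (integral {0..t} (\<lambda>y. V s y * (1 - life_tail (t - y))))"
proof -
  interpret P: pair_sigma_finite lborel \<mu> ..
  have [measurable]: "Measurable.pred (borel \<Otimes>\<^sub>M borel) (\<lambda>p. snd p \<in> {0<..fst p::real})"
    "Measurable.pred (borel \<Otimes>\<^sub>M borel) (\<lambda>p. snd p \<in> {0<..t - fst p::real})"
    unfolding greaterThanAtMost_iff by measurable
  have ind: "indicator {0<..u} r = (if 0 < r \<and> r \<le> u then 1 else 0 :: ennreal)" for u r :: real
    by (simp add: indicator_def)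
  have ind': "indicator {0..u} r = (if 0 \<le> r \<and> r \<le> u then 1 else 0 :: ennreal)" for u r :: real
    by (simp add: indicator_def)
  have "(\<integral>\<^sup>+u. (\<integral>\<^sup>+r. ennreal (V s (u - r)) * indicator {0<..u} r \<partial>\<mu>) * indicator {0..t} u \<partial>lborel)
    = (\<integral>\<^sup>+u. \<integral>\<^sup>+r. ennreal (V s (u - r)) * indicator {0<..u} r * indicator {0..t} u \<partial>\<mu> \<partial>lborel)"
    by (intro nn_integral_cong nn_integral_multc[symmetric]) simp
  also have "\<dots> = (\<integral>\<^sup>+r. \<integral>\<^sup>+u. ennreal (V s (u - r)) * indicator {0<..u} r * indicator {0..t} u \<partial>lborel \<partial>\<mu>)"
    unfolding ind ind' by (intro P.Fubini'[symmetric]) measurable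
  also have "\<dots> = (\<integral>\<^sup>+r. \<integral>\<^sup>+y. ennreal (V s y) * indicator {0..t} y * indicator {0<..t - y} r \<partial>lborel \<partial>\<mu>)"
  proof (rule nn_integral_cong)
    fix r
    have "(\<integral>\<^sup>+u. ennreal (V s (u - r)) * indicator {0<..u} r * indicator {0..t} u \<partial>lborel)
      = (\<integral>\<^sup>+y. ennreal (V s ((r + 1 * y) - r)) * indicator {0<..r + 1 * y} r * indicator {0..t} (r + 1 * y) \<partial>lborel)"
      unfolding ind ind' by (subst nn_integral_real_affine[where c=1 and t=r]) simp_all
    also have "\<dots> = (\<integral>\<^sup>+y. ennreal (V s y) * indicator {0..t} y * indicator {0<..t - y} r \<partial>lborel)"
      by (intro nn_integral_cong) (auto simp: indicator_def)
    finally show "(\<integral>\<^sup>+u. ennreal (V s (u - r)) * indicator {0<..u} r * indicator {0..t} u \<partial>lborel) = \<dots>" .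
  qed
  also have "\<dots> = (\<integral>\<^sup>+y. \<integral>\<^sup>+r. ennreal (V s y) * indicator {0..t} y * indicator {0<..t - y} r \<partial>\<mu> \<partial>lborel)"
    unfolding ind ind' by (intro P.Fubini') measurable
  also have "\<dots> = (\<integral>\<^sup>+y. ennreal (V s y * (1 - life_tail (t - y))) * indicator {0..t} y \<partial>lborel)"
  proof (rule nn_integral_cong)
    fix y
    have "(\<integral>\<^sup>+r. ennreal (V s y) * indicator {0..t} y * indicator {0<..t - y} r \<partial>\<mu>)
      = ennreal (V s y) * indicator {0..t} y * emeasure \<mu> {0<..t - y}"
      by (rule nn_integral_cmult_indicator) (simp add: sets_life)
    also have "\<dots> = ennreal (V s y * (1 - life_tail (t - y))) * indicator {0..t} y"
      by (auto simp: indicator_def emeasure_life_Ioc ennreal_mult V_nonneg)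
    finally show "(\<integral>\<^sup>+r. ennreal (V s y) * indicator {0..t} y * indicator {0<..t - y} r \<partial>\<mu>) = \<dots>" .
  qed
  also have "\<dots> = ennreal (integral {0..t} (\<lambda>y. V s y * (1 - life_tail (t - y))))"
  proof (rule nn_integral_Icc_eq_integral)
    fix x assume "x \<in> {0..t}"
    then show "V s x * (1 - life_tail (t - x)) \<le> V s t * 1"
      using V_mono[of x t] V_nonneg by (intro mult_mono) auto
  qed (auto simp: V_nonneg)
  finally show ?thesis .
qed

text \<open>Integrating \<open>V_times_g\<close> over \<open>[0, t]\<close> evaluates the integral
  of \<open>V s * g s\<close>, which also occurs in \<open>V_integral\<close>. When the two are
  combined, the integral of \<open>V s\<close> itself cancels and only the convolution with the tail
  remains.\<close>

lemma V_renewal: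
  assumes \<delta>: "0 < \<delta>" and t: "0 \<le> t"
  shows "V s t = 1 - \<delta> * s * integral {0..t} life_tail + \<delta> * integral {0..t} (\<lambda>y. V s y * life_tail (t - y))"
proof -
  \<comment> \<open>\<open>q u\<close> is the share of the lives that have ended by time
    \<open>u\<close>. Written as a difference of real functions, it gives the inner nonnegative
    integral a real value.\<close>
  define q where "q u = V s u * g s u - s * life_tail u" for u
  have [measurable]: "q \<in> borel_measurable borel" unfolding q_def by measurable
  have q: "0 \<le> q u" "ennreal (q u) = (\<integral>\<^sup>+r. ennreal (V s (u - r)) * indicator {0<..u} r \<partial>\<mu>)" if u: "0 \<le> u" for u
  proof -
    note * = V_times_g[OF \<delta> u]
    have "ennreal (s * life_tail u) \<le> ennreal (V s u * g s u)" unfolding * by simp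
    then show "0 \<le> q u" using V_nonneg[of u] s by (simp add: q_def)
    then show "ennreal (q u) = (\<integral>\<^sup>+r. ennreal (V s (u - r)) * indicator {0<..u} r \<partial>\<mu>)"
      using s unfolding q_def by (subst ennreal_minus[symmetric]) (simp_all add: *)
  qed
  have qV: "q u \<le> V s t" if "u \<in> {0..t}" for u
  proof -
    have "V s u * g s u \<le> V s t * 1"
      using that V_mono[of u t] V_nonneg g_le_1[OF s] by (intro mult_mono) auto
    moreover have "0 \<le> s * life_tail u" using s by simp
    ultimately show ?thesis unfolding q_def by linarith
  qed
  have qint: "q integrable_on {0..t}"
    using q qV by (intro bounded_borel_integrable_on[where B="V s t"]) auto
  have "ennreal (integral {0..t} q) = (\<integral>\<^sup>+u\<in>{0..t}. ennreal (q u) \<partial>lborel)"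
    using q qV by (intro nn_integral_Icc_eq_integral[symmetric, where B="V s t"]) auto
  also have "\<dots> = (\<integral>\<^sup>+u. (\<integral>\<^sup>+r. ennreal (V s (u - r)) * indicator {0<..u} r \<partial>\<mu>) * indicator {0..t} u \<partial>lborel)"
    by (intro nn_integral_cong) (auto simp: indicator_def q(2))
  also have "\<dots> = ennreal (integral {0..t} (\<lambda>y. V s y * (1 - life_tail (t - y))))"
    by (rule nn_integral_V_convolution[OF t])
  finally have Q: "integral {0..t} q = integral {0..t} (\<lambda>y. V s y * (1 - life_tail (t - y)))"
    using q V_nonneg by (subst (asm) ennreal_inj)
      (auto intro!: integral_nonneg qint V_mult_integrable)
  have i: "(\<lambda>y. V s y * life_tail (t - y)) integrable_on {0..t}" "(\<lambda>y. V s y * g s y) integrable_on {0..t}"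
    "(\<lambda>y. V s y * 1) integrable_on {0..t}"
    by (intro V_mult_integrable; simp add: g_le_1[OF s])+
  have "integral {0..t} (\<lambda>y. V s y * (1 - life_tail (t - y))) = integral {0..t} (\<lambda>y. V s y * 1) - integral {0..t} (\<lambda>y. V s y * life_tail (t - y))"
    unfolding right_diff_distrib by (intro Henstock_Kurzweil_Integration.integral_diff i)
  moreover have "integral {0..t} q = integral {0..t} (\<lambda>y. V s y * g s y) - s * integral {0..t} life_tail"
    unfolding q_def by (subst Henstock_Kurzweil_Integration.integral_diff) (auto intro!: i integrable_on_mult_right)
  moreover have "integral {0..t} (\<lambda>y. V s y * (1 - g s y)) = integral {0..t} (\<lambda>y. V s y * 1) - integral {0..t} (\<lambda>y. V s y * g s y)"
    unfolding right_diff_distrib by (intro Henstock_Kurzweil_Integration.integral_diff i)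
  ultimately have eq: "integral {0..t} (\<lambda>y. V s y * (1 - g s y)) = integral {0..t} (\<lambda>y. V s y * life_tail (t - y)) - s * integral {0..t} life_tail"
    using Q by linarith
  have "V s t = 1 + \<delta> * (integral {0..t} (\<lambda>y. V s y * life_tail (t - y)) - s * integral {0..t} life_tail)"
    using V_integral[OF t] by (simp only: eq)
  then show ?thesis by (simp add: right_diff_distrib mult.assoc)
qed

text \<open>\<open>U\<close> solves a renewal equation in which \<open>s\<close> does not occur, so it does not depend on \<open>s\<close>.\<close>

definition U :: "real \<Rightarrow> real" where
  "U t = (V s t - s) / (1 - s)"

lemma measurable_U [measurable]: "U \<in> borel_measurable borel"
  unfolding U_def by measurable

lemma U_mono: "0 \<le> a \<Longrightarrow> a \<le> b \<Longrightarrow> U a \<le> U b"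
  unfolding U_def using V_mono s by (intro divide_right_mono) auto

lemma U_ge_1: "1 \<le> U t"
  unfolding U_def using V_ge_1[of t] s by simp

text \<open>The term of \<open>V_renewal\<close> with the factor \<open>s\<close> is, up to sign,
  \<open>\<delta>\<close> times the convolution of the constant \<open>s\<close> with the tail.
  Subtracting \<open>s\<close> from \<open>V s\<close> absorbs it and leaves the constant
  \<open>1 - s\<close>, which the division normalises to 1.\<close>

lemma U_renewal:
  assumes \<delta>: "0 < \<delta>" and t: "0 \<le> t"
  shows "U t = 1 + \<delta> * integral {0..t} (\<lambda>y. U y * life_tail (t - y))"
proof -
  have "integral {0..t} (\<lambda>y. life_tail (t - y)) = integral {0..t} life_tail"
    using integral_reflect_shift[of 0 t life_tail t] by simp
  moreover have "integral {0..t} (\<lambda>y. U y * life_tail (t - y)) =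
     (integral {0..t} (\<lambda>y. V s y * life_tail (t - y)) - s * integral {0..t} (\<lambda>y. life_tail (t - y))) / (1 - s)"
  proof -
    have "(\<lambda>y. U y * life_tail (t - y)) = (\<lambda>y. (V s y * life_tail (t - y) - s * life_tail (t - y)) / (1 - s))"
      by (simp add: U_def fun_eq_iff left_diff_distrib)
    moreover have "integral {0..t} (\<lambda>y. V s y * life_tail (t - y) - s * life_tail (t - y)) =
       integral {0..t} (\<lambda>y. V s y * life_tail (t - y)) - integral {0..t} (\<lambda>y. s * life_tail (t - y))"
      by (intro Henstock_Kurzweil_Integration.integral_diff V_mult_integrable integrable_on_mult_right) auto
    ultimately show ?thesis by simp
  qed
  moreover have "U t = ((1 - s) + \<delta> * (integral {0..t} (\<lambda>y. V s y * life_tail (t - y)) - s * integral {0..t} life_tail)) / (1 - s)"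
    unfolding U_def using V_renewal[OF \<delta> t] by (simp add: right_diff_distrib)
  ultimately show ?thesis using s by (simp add: add_divide_distrib)
qed

end

end

section \<open>Expected occupation times\<close>

lemma LIMSEQ_integral_Icc:
  fixes f :: "real \<Rightarrow> real"
  assumes [measurable]: "f \<in> borel_measurable borel" and f: "\<And>x. 0 \<le> f x" "\<And>x. f x \<le> B"
  shows "(\<lambda>n. ennreal (integral {0..real n} f)) \<longlonglongrightarrow> (\<integral>\<^sup>+x\<in>{0..}. ennreal (f x) \<partial>lborel)"
proof -
  have "(\<lambda>n. \<integral>\<^sup>+x. ennreal (f x) * indicator {0..real n} x \<partial>lborel) \<longlonglongrightarrow> (\<integral>\<^sup>+x. ennreal (f x) * indicator {0..} x \<partial>lborel)"
  proof (rule nn_integral_LIMSEQ)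
    show "incseq (\<lambda>n x. ennreal (f x) * indicator {0..real n} x)"
      by (auto simp: incseq_def le_fun_def indicator_def)
    fix x :: real
    have "eventually (\<lambda>n. ennreal (f x) * indicator {0..} x = ennreal (f x) * indicator {0..real n} x) sequentially"
      using eventually_ge_at_top[of "nat \<lceil>x\<rceil>"]
    proof eventually_elim
      case (elim n)
      then have "x \<le> real n" by linarith
      then show ?case by (simp add: indicator_def)
    qed
    then show "(\<lambda>n. ennreal (f x) * indicator {0..real n} x) \<longlonglongrightarrow> ennreal (f x) * indicator {0..} x"
      by (rule Lim_transform_eventually[OF tendsto_const])
  qed simp
  also have "(\<lambda>n. \<integral>\<^sup>+x. ennreal (f x) * indicator {0..real n} x \<partial>lborel) = (\<lambda>n. ennreal (integral {0..real n} f))"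
    using f by (intro ext nn_integral_Icc_eq_integral[where B=B]) auto
  finally show ?thesis .
qed

lemma pop_root_cases: "pop_root r z t = \<infinity> \<or> (\<exists>n. pop_root r z t = of_nat n)"
  by (auto simp: pop_root_def emeasure_count_space)

lemma pop_power_suminf:
  assumes "0 < s" "x = \<infinity> \<or> (\<exists>n. x = of_nat n)"
  shows "pop_power s x = (\<Sum>K. ennreal (s ^ K) * of_bool (x = of_nat K))"
proof (cases "x = \<infinity>")
  case True
  then show ?thesis by (simp add: pop_power_def)
next
  case False
  then obtain n where n: "x = of_nat n" using assms by auto
  have "(\<Sum>K. ennreal (s ^ K) * of_bool (x = of_nat K)) = (\<Sum>K\<in>{n}. ennreal (s ^ K) * of_bool (x = of_nat K))"
    by (rule suminf_finite) (auto simp: n)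
  then show ?thesis
    using \<open>0 < s\<close> by (simp add: n pop_power_def powr_realpow)
qed

context life_tree
begin

definition pop_prob :: "nat \<Rightarrow> real \<Rightarrow> real" where
  "pop_prob K t = measure L {z. pop_root (config_life z []) z t = of_nat K}"

definition occupation :: "nat \<Rightarrow> real \<Rightarrow> real" where
  "occupation K t = integral {0..t} (pop_prob K)"

lemma pop_prob_eq_nn_integral:
  "ennreal (pop_prob K t) = (\<integral>\<^sup>+z. of_bool (pop_root (config_life z []) z t = of_nat K) \<partial>L)"
proof -
  have S: "{z. pop_root (config_life z []) z t = of_nat K} \<in> sets L"
  proof -
    have "Measurable.pred L (\<lambda>z. pop_root (config_life z []) z t = of_nat K)" by measurable
    then show ?thesis by (simp add: pred_def)
  qed
  have "ennreal (pop_prob K t) = (\<integral>\<^sup>+z. indicator {z. pop_root (config_life z []) z t = of_nat K} z \<partial>L)"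
    unfolding pop_prob_def using S by (simp add: L.emeasure_eq_measure)
  then show ?thesis by (simp add: indicator_def)
qed

lemma pop_prob_bounds [simp]: "0 \<le> pop_prob K t" "pop_prob K t \<le> 1"
  by (simp_all add: pop_prob_def)

lemma measurable_pop_prob [measurable]: "pop_prob K \<in> borel_measurable borel"
proof -
  have "(\<lambda>t. enn2real (\<integral>\<^sup>+z. of_bool (pop_root (config_life z []) z t = of_nat K) \<partial>L)) \<in> borel_measurable borel"
    by measurable
  then show ?thesis by (simp add: pop_prob_eq_nn_integral[symmetric])
qed

lemma occupation_nonneg: "0 \<le> occupation K t"
  unfolding occupation_def by (intro Henstock_Kurzweil_Integration.integral_nonneg bounded_borel_integrable_on[where B=1]) auto

text \<open>All terms are nonnegative, so summation over \<open>K\<close> commutes with both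
  integrations, and the sum is the integral of \<open>g s\<close>. The index \<open>K = 0\<close> is
  included, and an infinite population contributes to no term, in agreement with
  \<open>pop_power\<close>.\<close>

lemma occupation_sums:
  assumes s: "0 < s" "s < 1" and t: "0 \<le> t"
  shows "(\<lambda>K. occupation K t * s ^ K) sums (t - F s t)"
proof -
  have G: "G s u = (\<Sum>K. ennreal (s ^ K) * ennreal (pop_prob K u))" for u
  proof -
    have "G s u = (\<integral>\<^sup>+z. (\<Sum>K. ennreal (s ^ K) * of_bool (pop_root (config_life z []) z u = of_nat K)) \<partial>L)"
      unfolding G_def by (intro nn_integral_cong pop_power_suminf s pop_root_cases)
    also have "\<dots> = (\<Sum>K. ennreal (s ^ K) * (\<integral>\<^sup>+z. of_bool (pop_root (config_life z []) z u = of_nat K) \<partial>L))"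
      by (simp add: nn_integral_suminf nn_integral_cmult)
    finally show ?thesis by (simp only: pop_prob_eq_nn_integral)
  qed
  have "ennreal (integral {0..t} (g s)) = (\<integral>\<^sup>+u\<in>{0..t}. ennreal (g s u) \<partial>lborel)"
    using g_le_1[OF s] by (intro nn_integral_Icc_eq_integral[symmetric, where B=1]) auto
  also have "\<dots> = (\<integral>\<^sup>+u. (\<Sum>K. ennreal (s ^ K) * (ennreal (pop_prob K u) * indicator {0..t} u)) \<partial>lborel)"
    by (simp add: G_eq[OF s, symmetric] G mult.assoc[symmetric])
  also have "\<dots> = (\<Sum>K. ennreal (s ^ K) * (\<integral>\<^sup>+u\<in>{0..t}. ennreal (pop_prob K u) \<partial>lborel))"
    by (simp add: nn_integral_suminf nn_integral_cmult)
  also have "\<dots> = (\<Sum>K. ennreal (occupation K t * s ^ K))"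
  proof -
    have "(\<integral>\<^sup>+u\<in>{0..t}. ennreal (pop_prob K u) \<partial>lborel) = ennreal (occupation K t)" for K
      unfolding occupation_def by (intro nn_integral_Icc_eq_integral[where B=1]) auto
    then show ?thesis using s occupation_nonneg by (simp add: ennreal_mult mult.commute)
  qed
  finally have "(\<lambda>K. ennreal (occupation K t * s ^ K)) sums ennreal (integral {0..t} (g s))"
    by (simp add: summable_sums)
  moreover have "0 \<le> integral {0..t} (g s)"
    using g_le_1[OF s] by (intro Henstock_Kurzweil_Integration.integral_nonneg bounded_borel_integrable_on[where B=1]) auto
  ultimately have "(\<lambda>K. occupation K t * s ^ K) sums integral {0..t} (g s)"
    using occupation_nonneg s by (subst (asm) sums_ennreal) auto
  also have "integral {0..t} (g s) = t - F s t"
  proof -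
    have "F s t = integral {0..t} (\<lambda>u. 1) - integral {0..t} (g s)"
      unfolding F_def using g_le_1[OF s]
      by (intro Henstock_Kurzweil_Integration.integral_diff bounded_borel_integrable_on[where B=1]) auto
    with t show ?thesis by simp
  qed
  finally show ?thesis .
qed

text \<open>The choice of \<open>1 / 2\<close> is arbitrary, as \<open>U s\<close> turns out to be
  the same function for all \<open>s\<close>. In the theory of splitting trees \<open>W\<close> is
  the scale function of the associated Levy process.\<close>

abbreviation W :: "real \<Rightarrow> real" where
  "W \<equiv> U (1 / 2)"

lemma half_bounds: "0 < 1 / (2::real)" "1 / 2 < (1::real)"
  by simp_all

lemma V_eq_W:
  assumes \<delta>: "0 < \<delta>" and s: "0 < s" "s < 1" and t: "0 \<le> t"
  shows "V s t = s + (1 - s) * W t"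
proof -
  have "U s t = W t"
  proof (rule renewal_unique[where ?W1.0="U s" and ?W2.0=W and T=t and m=life_tail and d=\<delta> and B="max (U s t) (W t)"])
    show "U s u = 1 + \<delta> * integral {0..u} (\<lambda>y. U s y * life_tail (u - y))" if "u \<in> {0..t}" for u
      using that by (intro U_renewal s \<delta>) auto
    show "W u = 1 + \<delta> * integral {0..u} (\<lambda>y. W y * life_tail (u - y))" if "u \<in> {0..t}" for u
      using that by (intro U_renewal half_bounds \<delta>) auto
    show "\<bar>U s x\<bar> \<le> max (U s t) (W t)" "\<bar>W x\<bar> \<le> max (U s t) (W t)" if "x \<in> {0..t}" for x
      using that U_mono[OF s, of x t] U_ge_1[OF s, of x] U_mono[OF half_bounds, of x t] U_ge_1[OF half_bounds, of x]
      by auto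
  qed (use t \<delta> in \<open>auto intro: measurable_U[OF s] measurable_U[OF half_bounds]\<close>)
  then show ?thesis using s unfolding U_def[OF s] by (simp add: field_simps)
qed

text \<open>Under the logarithm, \<open>s + (1 - s) * w\<close> factors as
  \<open>w * (1 - \<theta> * s)\<close>. The second factor yields the logarithmic series in
  \<open>\<theta> * s\<close>, while \<open>ln w\<close> affects the constant coefficient
  only.\<close>

lemma occupation_explicit:
  assumes \<delta>: "0 < \<delta>" and t: "0 \<le> t" and K: "1 \<le> K"
  shows "occupation K t = (1 - 1 / W t) ^ K / (\<delta> * real K)"
proof -
  define w where "w = W t"
  define \<theta> where "\<theta> = 1 - 1 / w"
  have w: "1 \<le> w" using U_ge_1[OF half_bounds] by (simp add: w_def)
  have \<theta>: "0 \<le> \<theta>" "\<theta> < 1" using w by (auto simp: \<theta>_def)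
  \<comment> \<open>At \<open>n = 0\<close> the second summand divides by 0 and is therefore 0, so
    the constant coefficient is \<open>t - ln w / \<delta>\<close> alone.\<close>
  define b where "b n = (if n = 0 then t - ln w / \<delta> else 0) + \<theta> ^ n / (\<delta> * real n)" for n
  have "(\<lambda>K. occupation K t) = b"
  proof (rule powser_unique_right)
    fix s :: real assume s: "0 < s" "s < 1"
    show "(\<lambda>K. occupation K t * s ^ K) sums (t - F s t)" by (rule occupation_sums[OF s t])
    have \<theta>s: "0 \<le> \<theta> * s" "\<theta> * s < 1" using \<theta> s mult_strict_mono[of \<theta> 1 s 1] by auto
    have "(\<lambda>n. - ((\<theta> * s) ^ n) / real n) sums ln (1 - \<theta> * s)"
      using ln_series'[of "- (\<theta> * s)"] \<theta>s by simp
    from sums_mult[OF this, of "- (1 / \<delta>)"]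
    have l: "(\<lambda>n. \<theta> ^ n / (\<delta> * real n) * s ^ n) sums (- (ln (1 - \<theta> * s) / \<delta>))"
      by (simp add: power_mult_distrib mult_ac)
    have "(\<lambda>n. (if n = 0 then t - ln w / \<delta> else 0) * s ^ n) sums (t - ln w / \<delta>)"
      using sums_single[of 0 "\<lambda>n. (t - ln w / \<delta>) * s ^ n"] by (simp add: if_distrib[of "\<lambda>x. x * _"] cong: if_cong)
    from sums_add[OF this l] have "(\<lambda>n. b n * s ^ n) sums (t - ln w / \<delta> + - (ln (1 - \<theta> * s) / \<delta>))"
      by (simp add: b_def distrib_right)
    also have "t - ln w / \<delta> + - (ln (1 - \<theta> * s) / \<delta>) = t - F s t"
    proof -
      have "w * (1 - \<theta> * s) = s + (1 - s) * w" using w by (simp add: \<theta>_def field_simps)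
      then have "V s t = w * (1 - \<theta> * s)" using V_eq_W[OF \<delta> s t] by (simp add: w_def)
      then have "\<delta> * F s t = ln (w * (1 - \<theta> * s))" by (metis V_def ln_exp)
      also have "\<dots> = ln w + ln (1 - \<theta> * s)" using w \<theta>s by (intro ln_mult_pos) auto
      finally have "F s t = (ln w + ln (1 - \<theta> * s)) / \<delta>" using \<delta> by (simp add: field_simps)
      then show ?thesis by (simp add: add_divide_distrib)
    qed
    finally show "(\<lambda>n. b n * s ^ n) sums (t - F s t)" .
  qed
  then have "occupation K t = b K" by (rule fun_cong)
  then show ?thesis using K by (simp add: b_def \<theta>_def w_def)
qed

text \<open>Layer-cake formula: the integral of the tail is the mean life, which is 1. The law of
  the life-length affects the limits through this number only.\<close>

lemma LIMSEQ_integral_life_tail: "(\<lambda>n. integral {0..real n} life_tail) \<longlonglongrightarrow> 1"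
proof -
  interpret P: pair_sigma_finite lborel \<mu> ..
  have "(\<integral>\<^sup>+x\<in>{0..}. ennreal (life_tail x) \<partial>lborel) = (\<integral>\<^sup>+x. \<integral>\<^sup>+r. of_bool (0 \<le> x \<and> x < r) \<partial>\<mu> \<partial>lborel)"
  proof (intro nn_integral_cong)
    fix x :: real
    have "(\<integral>\<^sup>+r. of_bool (0 \<le> x \<and> x < r) \<partial>\<mu>) = (\<integral>\<^sup>+r. indicator {0..} x * indicator {x<..} r \<partial>\<mu>)"
      by (intro nn_integral_cong) (auto simp: indicator_def)
    also have "\<dots> = ennreal (life_tail x) * indicator {0..} x"
      by (subst nn_integral_cmult_indicator) (auto simp: sets_life life_tail_def life.emeasure_eq_measure mult.commute)
    finally show "ennreal (life_tail x) * indicator {0..} x = (\<integral>\<^sup>+r. of_bool (0 \<le> x \<and> x < r) \<partial>\<mu>)" by simp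
  qed
  also have "\<dots> = (\<integral>\<^sup>+r. \<integral>\<^sup>+x. of_bool (0 \<le> x \<and> x < r) \<partial>lborel \<partial>\<mu>)"
    by (intro P.Fubini'[symmetric]) measurable
  also have "\<dots> = (\<integral>\<^sup>+r. ennreal r \<partial>\<mu>)"
  proof (rule nn_integral_cong_AE)
    show "AE r in \<mu>. (\<integral>\<^sup>+x. of_bool (0 \<le> x \<and> x < r) \<partial>lborel) = ennreal r"
      using life_pos
    proof eventually_elim
      fix r :: real assume r: "0 < r"
      have "(\<integral>\<^sup>+x. of_bool (0 \<le> x \<and> x < r) \<partial>lborel) = (\<integral>\<^sup>+x. indicator {0..<r} x \<partial>lborel)"
        by (intro nn_integral_cong) (auto simp: indicator_def)
      then show "(\<integral>\<^sup>+x. of_bool (0 \<le> x \<and> x < r) \<partial>lborel) = ennreal r"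
        using r by simp
    qed
  qed
  finally have "(\<lambda>n. ennreal (integral {0..real n} life_tail)) \<longlonglongrightarrow> ennreal 1"
    using LIMSEQ_integral_Icc[of life_tail 1] life_mean by simp
  then show ?thesis
    by (rule tendsto_ennrealD) (auto intro!: always_eventually integral_nonneg)
qed

text \<open>Both estimates compare \<open>W\<close> with its value at \<open>n\<close> in the
  renewal equation. The upper one replaces \<open>W y\<close> by \<open>W n\<close> on all of
  \<open>[0, n]\<close>; the lower one, at time \<open>2 * n\<close>, keeps only
  \<open>y \<ge> n\<close>, where \<open>W y \<ge> W n\<close> and the reflected tail still runs
  over all of \<open>[0, n]\<close>.\<close>

lemma W_bounds:
  assumes \<delta>: "0 < \<delta>"
  shows "W (real n) \<le> 1 + \<delta> * W (real n)"
    and "1 + \<delta> * (W (real n) * integral {0..real n} life_tail) \<le> W (real (2 * n))"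
proof -
  note W_mono = U_mono[OF half_bounds] and W_ge_1 = U_ge_1[OF half_bounds]
  have [measurable]: "W \<in> borel_measurable borel" by (rule measurable_U[OF half_bounds])
  have W_nonneg: "0 \<le> W x" for x using W_ge_1[of x] by linarith
  have int: "(\<lambda>y. W y * life_tail (t - y)) integrable_on {x..t}" if "0 \<le> x" for x t
  proof (rule bounded_borel_integrable_on[where B="W t * 1"])
    fix y assume "y \<in> {x..t}"
    then show "\<bar>W y * life_tail (t - y)\<bar> \<le> W t * 1"
      unfolding abs_mult using W_mono[of y t] W_nonneg that by (intro mult_mono) auto
  qed measurable
  have m_le: "integral {0..real n} life_tail \<le> 1"
  proof (rule LIMSEQ_le_const[OF LIMSEQ_integral_life_tail], intro exI allI impI)
    fix k assume "n \<le> k"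
    then show "integral {0..real n} life_tail \<le> integral {0..real k} life_tail"
      by (intro integral_subset_le) auto
  qed
  have refl: "integral {x..t} (\<lambda>y. life_tail (t - y)) = integral {0..t - x} life_tail" for x t
    using integral_reflect_shift[of x t life_tail t] by simp
  have "integral {0..real n} (\<lambda>y. W y * life_tail (real n - y)) \<le> integral {0..real n} (\<lambda>y. W (real n) * life_tail (real n - y))"
    using W_mono by (intro integral_le int integrable_on_mult_right) (auto intro!: mult_right_mono)
  also have "\<dots> = W (real n) * integral {0..real n} life_tail"
    using refl[of 0 "real n"] by simp
  also have "\<dots> \<le> W (real n) * 1"
    using m_le W_nonneg by (intro mult_left_mono)
  finally show "W (real n) \<le> 1 + \<delta> * W (real n)"
    using U_renewal[OF half_bounds \<delta>, of "real n"] mult_left_mono[OF _ less_imp_le[OF \<delta>]] by simp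
  let ?t = "real (2 * n)"
  have "W (real n) * integral {0..real n} life_tail = integral {real n..?t} (\<lambda>y. W (real n) * life_tail (?t - y))"
    using refl[of "real n" ?t] by simp
  also have "\<dots> \<le> integral {real n..?t} (\<lambda>y. W y * life_tail (?t - y))"
    using W_mono by (intro integral_le int integrable_on_mult_right) (auto intro!: mult_right_mono)
  also have "\<dots> \<le> integral {0..?t} (\<lambda>y. W y * life_tail (?t - y))"
    using W_nonneg by (intro integral_subset_le int) auto
  finally show "1 + \<delta> * (W (real n) * integral {0..real n} life_tail) \<le> W (real (2 * n))"
    using U_renewal[OF half_bounds \<delta>, of ?t] mult_left_mono[OF _ less_imp_le[OF \<delta>]] by simp
qed

lemma W_limit_equation:
  assumes \<delta>: "0 < \<delta>" and L: "(\<lambda>n. W (real n)) \<longlonglongrightarrow> l"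
  shows "l = 1 + \<delta> * l"
proof (rule antisym)
  show "l \<le> 1 + \<delta> * l"
    using W_bounds(1)[OF \<delta>] by (intro LIMSEQ_le[OF L tendsto_add[OF tendsto_const tendsto_mult[OF tendsto_const L]]]) auto
  have "(\<lambda>n. W (real (2 * n))) \<longlonglongrightarrow> l"
    using LIMSEQ_subseq_LIMSEQ[OF L, of "\<lambda>n. 2 * n"] by (simp add: o_def strict_mono_def)
  moreover have "(\<lambda>n. 1 + \<delta> * (W (real n) * integral {0..real n} life_tail)) \<longlonglongrightarrow> 1 + \<delta> * (l * 1)"
    by (intro tendsto_intros L LIMSEQ_integral_life_tail)
  ultimately show "1 + \<delta> * l \<le> l"
    using W_bounds(2)[OF \<delta>] by (intro LIMSEQ_le[of _ "1 + \<delta> * l" _ l]) auto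
qed

text \<open>If \<open>W\<close> stays bounded, its limit \<open>l \<ge> 1\<close> satisfies
  \<open>l * (1 - \<delta>) = 1\<close>, which forces \<open>\<delta> < 1\<close>. If not, the first
  estimate of \<open>W_bounds\<close> rules out \<open>\<delta> < 1\<close>, and
  \<open>1 / W\<close> tends to 0; the critical case belongs here.\<close>

lemma LIMSEQ_inverse_W:
  assumes \<delta>: "0 < \<delta>"
  shows "(\<lambda>n. 1 / W (real n)) \<longlonglongrightarrow> max 0 (1 - \<delta>)"
proof -
  have W1: "1 \<le> W x" for x by (rule U_ge_1[OF half_bounds])
  have inc: "incseq (\<lambda>n. W (real n))"
    by (auto simp: incseq_def intro!: U_mono[OF half_bounds])
  show ?thesis
  proof (cases "bdd_above (range (\<lambda>n. W (real n)))")
    case True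
    then obtain l where l: "(\<lambda>n. W (real n)) \<longlonglongrightarrow> l"
      using LIMSEQ_incseq_SUP[OF True inc] by blast
    have "1 \<le> l" using W1 by (intro LIMSEQ_le_const[OF l]) auto
    moreover have "l * (1 - \<delta>) = 1" using W_limit_equation[OF \<delta> l] by (simp add: algebra_simps)
    ultimately have "1 - \<delta> = 1 / l" "0 < 1 / l" by (auto simp: eq_divide_eq mult.commute)
    then have "1 / l = max 0 (1 - \<delta>)" by simp
    moreover have "(\<lambda>n. 1 / W (real n)) \<longlonglongrightarrow> 1 / l"
      using \<open>1 \<le> l\<close> by (intro tendsto_intros l) auto
    ultimately show ?thesis by simp
  next
    case False
    have "1 \<le> \<delta>"
    proof (rule ccontr)
      assume "\<not> 1 \<le> \<delta>"
      then have "W (real n) \<le> 1 / (1 - \<delta>)" for n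
        using W_bounds(1)[OF \<delta>, of n] by (simp add: field_simps)
      with False show False by (auto intro!: bdd_aboveI)
    qed
    moreover have "filterlim (\<lambda>n. W (real n)) at_top sequentially"
      unfolding filterlim_at_top
    proof
      fix Z
      obtain N where "Z < W (real N)" using False by (auto simp: bdd_above_def not_le)
      then show "eventually (\<lambda>n. Z \<le> W (real n)) sequentially"
        using incseqD[OF inc] by (intro eventually_sequentiallyI[of N]) (meson less_imp_le order_trans)
    qed
    then have "(\<lambda>n. 1 / W (real n)) \<longlonglongrightarrow> 0"
      by (intro tendsto_divide_0[OF tendsto_const] filterlim_mono[OF _ at_top_le_at_infinity order_refl])
    ultimately show ?thesis by simp
  qed
qed

definition mean_occupation :: "nat \<Rightarrow> ennreal" where
  "mean_occupation K = (\<integral>\<^sup>+t\<in>{0..}. ennreal (pop_prob K t) \<partial>lborel)"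

lemma LIMSEQ_occupation: "(\<lambda>n. ennreal (occupation K (real n))) \<longlonglongrightarrow> mean_occupation K"
  unfolding mean_occupation_def occupation_def by (rule LIMSEQ_integral_Icc[where B=1]) auto

lemma mean_occupation_pos_rate:
  assumes \<delta>: "0 < \<delta>" and K: "1 \<le> K"
  shows "mean_occupation K = ennreal (min 1 \<delta> ^ K / (\<delta> * real K))"
proof -
  have "(\<lambda>n. occupation K (real n)) \<longlonglongrightarrow> (1 - max 0 (1 - \<delta>)) ^ K / (\<delta> * real K)"
    using \<delta> K by (subst occupation_explicit) (auto intro!: tendsto_intros LIMSEQ_inverse_W)
  also have "1 - max 0 (1 - \<delta>) = min 1 \<delta>" by (simp add: max_def min_def)
  finally show ?thesis
    by (intro LIMSEQ_unique[OF LIMSEQ_occupation] tendsto_ennrealI)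
qed

text \<open>The subcritical range contains 0, where the closed form would divide by 0. Without
  births the population is 1 during the life of the ancestor and 0 afterwards, so the generating
  function is read off directly.\<close>

lemma mean_occupation_zero_rate:
  assumes \<delta>: "\<delta> = 0" and K: "1 \<le> K"
  shows "mean_occupation K = of_bool (K = 1)"
proof -
  have g: "g s u = 1 - (1 - s) * life_tail u" if s: "0 < s" "s < 1" and u: "0 \<le> u" for s u
  proof -
    have "\<psi> s r u = ennreal (s powr of_bool (u < r))" for r
      using s u by (subst \<psi>_first_birth) (simp_all add: waiting_time_law_def \<delta> nn_integral_return)
    then have "G s u = (\<integral>\<^sup>+r. ennreal (s powr of_bool (u < r)) \<partial>\<mu>)"
      by (simp add: G_eq_nn_integral_\<psi>)
    also have "\<dots> = (\<integral>\<^sup>+r. indicator {..u} r + ennreal s * indicator {u<..} r \<partial>\<mu>)"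
      using s by (intro nn_integral_cong) (auto simp: indicator_def)
    also have "\<dots> = emeasure \<mu> {..u} + ennreal s * emeasure \<mu> {u<..}"
      by (subst nn_integral_add) (auto simp: nn_integral_cmult_indicator sets_life)
    also have "emeasure \<mu> {..u} = ennreal (1 - life_tail u)"
    proof -
      have "{..u} = space \<mu> - {u<..}" by auto
      then show ?thesis
        unfolding life.emeasure_eq_measure life_tail_def by (simp only:) (subst life.prob_compl, auto simp: sets_life)
    qed
    also have "ennreal (1 - life_tail u) + ennreal s * emeasure \<mu> {u<..} = ennreal (1 - (1 - s) * life_tail u)"
      using s by (simp add: life.emeasure_eq_measure life_tail_def[symmetric] algebra_simps flip: ennreal_mult ennreal_plus)
    finally show ?thesis
      using s mult_mono[of "1 - s" 1 "life_tail u" 1] by (simp add: g_def)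
  qed
  have F: "F s t = (1 - s) * integral {0..t} life_tail" if s: "0 < s" "s < 1" for s t
  proof -
    have "F s t = integral {0..t} (\<lambda>u. (1 - s) * life_tail u)"
      unfolding F_def using s by (intro integral_cong) (simp add: g)
    then show ?thesis by simp
  qed
  have "occupation K t = (if K = 0 then t - integral {0..t} life_tail else if K = 1 then integral {0..t} life_tail else 0)" if t: "0 \<le> t" for t
  proof -
    let ?b = "\<lambda>K::nat. if K = 0 then t - integral {0..t} life_tail else if K = 1 then integral {0..t} life_tail else 0"
    have "(\<lambda>K. occupation K t) = ?b"
    proof (rule powser_unique_right)
      fix s :: real assume s: "0 < s" "s < 1"
      show "(\<lambda>K. occupation K t * s ^ K) sums (t - F s t)" by (rule occupation_sums[OF s t])
      have "(\<lambda>K. ?b K * s ^ K) sums (\<Sum>K\<in>{0, 1}. ?b K * s ^ K)"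
        by (rule sums_finite) auto
      then show "(\<lambda>K. ?b K * s ^ K) sums (t - F s t)"
        unfolding F[OF s] by (simp add: algebra_simps)
    qed
    then show ?thesis by (rule fun_cong)
  qed
  then have "(\<lambda>n. occupation K (real n)) = (if K = 1 then (\<lambda>n. integral {0..real n} life_tail) else (\<lambda>n. 0))"
    using K by auto
  then have "(\<lambda>n. occupation K (real n)) \<longlonglongrightarrow> of_bool (K = 1)"
    using LIMSEQ_integral_life_tail by simp
  then have "(\<lambda>n. ennreal (occupation K (real n))) \<longlonglongrightarrow> ennreal (of_bool (K = 1))"
    by (rule tendsto_ennrealI)
  then show ?thesis
    using LIMSEQ_unique[OF LIMSEQ_occupation] by fastforce
qed

end

section \<open>Return to the given tree and its expectations\<close>

lemma born_cong_ennreal: "(\<And>u. ennreal (l u) = ennreal (l' u)) \<Longrightarrow> born l w u = born l' w u"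
  by (induction u) auto

text \<open>Passing through a configuration replaces a negative life by 0, which
  \<open>ennreal\<close> does not distinguish. Hence the populations agree at every
  \<open>\<omega>\<close>, not only almost surely.\<close>

lemma alive_cong_ennreal: "(\<And>u. ennreal (l u) = ennreal (l' u)) \<Longrightarrow> alive l w t = alive l' w t"
  unfolding alive_def using born_cong_ennreal[of l l' w] by simp

lemma population_eq_enat_iff:
  "population l w t = enat K \<longleftrightarrow> emeasure (count_space UNIV) (alive l w t) = of_nat K"
  by (simp add: population_def emeasure_count_space)

context splitting_tree
begin

lemma population_config:
  "population (\<lambda>u. life u \<omega>) (\<lambda>u i. wait u i \<omega>) t = enat K \<longleftrightarrow>
    pop_root (config_life (config \<omega>) []) (config \<omega>) t = of_nat K"
proof -
  have w: "config_wait (config \<omega>) = (\<lambda>u i. wait u i \<omega>)"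
    by (auto simp: fun_eq_iff config_wait_def config_def)
  have "alive (\<lambda>u. life u \<omega>) (\<lambda>u i. wait u i \<omega>) t =
    alive ((config_life (config \<omega>))([] := config_life (config \<omega>) [])) (\<lambda>u i. wait u i \<omega>) t"
    by (rule alive_cong_ennreal) (auto simp: config_life_def config_def)
  then show ?thesis
    by (simp add: population_eq_enat_iff pop_root_def w)
qed

text \<open>The time in state \<open>K\<close> depends on \<open>\<omega>\<close> through
  \<open>config\<close> alone, so its expectation can be taken under the product law, where Tonelli
  exchanges it with the time integral.\<close>

lemma nn_integral_time_at:
  assumes "0 \<le> \<delta>"
  shows "(\<integral>\<^sup>+\<omega>. time_at (\<lambda>u. life u \<omega>) (\<lambda>u i. wait u i \<omega>) K \<partial>M)
    = (\<integral>\<^sup>+t\<in>{0..}. (\<integral>\<^sup>+z. of_bool (pop_root (config_life z []) z t = of_nat K) \<partial>config_law life_law \<delta>) \<partial>lborel)"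
    and "(\<lambda>\<omega>. time_at (\<lambda>u. life u \<omega>) (\<lambda>u i. wait u i \<omega>) K) \<in> borel_measurable M"
proof -
  interpret L: prob_space "config_law life_law \<delta>"
    by (intro prob_space_config_law life_law assms)
  interpret P: pair_sigma_finite "config_law life_law \<delta>" lborel ..
  note [measurable_cong] = sets_config_law[OF life_law assms]
  define D where "D z t = (of_bool (pop_root (config_life z []) z t = of_nat K) * indicator {0..} t :: ennreal)" for z and t :: real
  have [measurable]: "(\<lambda>x. D (f x) (h x)) \<in> borel_measurable N"
    if [measurable]: "f \<in> measurable N (PiM UNIV (\<lambda>_. borel))" "h \<in> borel_measurable N" for f h N
    unfolding D_def by measurable
  have time: "time_at (\<lambda>u. life u \<omega>) (\<lambda>u i. wait u i \<omega>) K = (\<integral>\<^sup>+t. D (config \<omega>) t \<partial>lborel)" for \<omega>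
    unfolding time_at_def by (intro nn_integral_cong) (simp add: D_def indicator_def population_config)
  show "(\<lambda>\<omega>. time_at (\<lambda>u. life u \<omega>) (\<lambda>u i. wait u i \<omega>) K) \<in> borel_measurable M"
    unfolding time by measurable
  have "(\<integral>\<^sup>+\<omega>. time_at (\<lambda>u. life u \<omega>) (\<lambda>u i. wait u i \<omega>) K \<partial>M) = (\<integral>\<^sup>+\<omega>. \<integral>\<^sup>+t. D (config \<omega>) t \<partial>lborel \<partial>M)"
    by (simp only: time)
  also have "\<dots> = (\<integral>\<^sup>+z. \<integral>\<^sup>+t. D z t \<partial>lborel \<partial>distr M (PiM UNIV (\<lambda>_. borel)) config)"
    by (subst nn_integral_distr) simp_all
  also have "\<dots> = (\<integral>\<^sup>+z. \<integral>\<^sup>+t. D z t \<partial>lborel \<partial>config_law life_law \<delta>)"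
    by (simp only: distr_config[OF assms])
  also have "\<dots> = (\<integral>\<^sup>+t. \<integral>\<^sup>+z. D z t \<partial>config_law life_law \<delta> \<partial>lborel)"
    by (intro P.Fubini'[symmetric]) measurable
  also have "\<dots> = (\<integral>\<^sup>+t\<in>{0..}. (\<integral>\<^sup>+z. of_bool (pop_root (config_life z []) z t = of_nat K) \<partial>config_law life_law \<delta>) \<partial>lborel)"
    unfolding D_def by (intro nn_integral_cong nn_integral_multc) measurable
  finally show "(\<integral>\<^sup>+\<omega>. time_at (\<lambda>u. life u \<omega>) (\<lambda>u i. wait u i \<omega>) K \<partial>M) = \<dots>" .
qed

end

text \<open>For \<open>\<delta> \<le> 1\<close> the value
  \<open>min 1 \<delta> ^ K / (\<delta> * K)\<close> becomes \<open>\<delta> ^ (K - 1) / K\<close>.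
  This form includes \<open>\<delta> = 0\<close>, where \<open>0 ^ 0 = 1\<close> gives the mean life
  at \<open>K = 1\<close>.\<close>

lemma (in splitting_tree) expected_time_at:
  assumes "0 \<le> \<delta>" "AE r in life_law. 0 < r" "(\<integral>\<^sup>+r. ennreal r \<partial>life_law) = 1" "1 \<le> K"
  shows "(\<integral>\<^sup>+\<omega>. time_at (\<lambda>u. life u \<omega>) (\<lambda>u i. wait u i \<omega>) K \<partial>M) =
    ennreal (if \<delta> \<le> 1 then \<delta> ^ (K - 1) / real K else 1 / (\<delta> * real K))"
proof -
  interpret T: life_tree life_law \<delta>
    by (rule life_tree.intro) (rule life_law assms)+
  have "(\<integral>\<^sup>+\<omega>. time_at (\<lambda>u. life u \<omega>) (\<lambda>u i. wait u i \<omega>) K \<partial>M) = T.mean_occupation K"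
    unfolding nn_integral_time_at(1)[OF assms(1)] T.mean_occupation_def T.pop_prob_eq_nn_integral ..
  also have "\<dots> = ennreal (if \<delta> \<le> 1 then \<delta> ^ (K - 1) / real K else 1 / (\<delta> * real K))"
  proof (cases "\<delta> = 0")
    case True
    have "T.mean_occupation K = of_bool (K = 1)"
      using True \<open>1 \<le> K\<close> by (rule T.mean_occupation_zero_rate)
    then show ?thesis using True \<open>1 \<le> K\<close> by (simp add: power_0_left)
  next
    case False
    then have "0 < \<delta>" using assms by simp
    have "min 1 \<delta> ^ K / (\<delta> * real K) = (if \<delta> \<le> 1 then \<delta> ^ (K - 1) / real K else 1 / (\<delta> * real K))"
      using \<open>0 < \<delta>\<close> \<open>1 \<le> K\<close> by (cases K) (auto simp: min_def)
    then show ?thesis using T.mean_occupation_pos_rate[OF \<open>0 < \<delta>\<close> \<open>1 \<le> K\<close>] by simp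
  qed
  finally show ?thesis .
qed

section \<open>The mean extinction time as a function of the birth rate\<close>

definition neg_log_quotient :: "real \<Rightarrow> real" where
  "neg_log_quotient x = (if x = 0 then 1 else - ln (1 - x) / x)"

text \<open>Dividing the logarithmic series by \<open>x\<close> yields the series of the mean times
  in the states \<open>K + 1\<close>. Its constant term is why the quotient takes the value 1 at
  0.\<close>

lemma neg_log_quotient_sums:
  assumes "0 \<le> x" "x < 1"
  shows "(\<lambda>K. x ^ K / real (Suc K)) sums neg_log_quotient x"
proof (cases "x = 0")
  case True
  then show ?thesis
    using sums_single[of 0 "\<lambda>K. 1 / real (Suc K)"]
    by (simp add: neg_log_quotient_def power_0_left if_distrib[of "\<lambda>x. x / _"] cong: if_cong)
next
  case False
  have "(\<lambda>n. - (x ^ n) / real n) sums ln (1 - x)"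
    using ln_series'[of "- x"] assms by simp
  then have "(\<lambda>n. - (x ^ Suc n) / real (Suc n)) sums ln (1 - x)"
    by (subst sums_Suc_iff) simp
  from sums_mult[OF this, of "- (1 / x)"] show ?thesis
    using False by (simp add: neg_log_quotient_def)
qed

text \<open>All differences of terms are nonnegative, and the linear one,
  \<open>(y - x) / 2\<close>, is already positive.\<close>

lemma neg_log_quotient_strict_mono:
  assumes "0 \<le> x" "x < y" "y < 1"
  shows "neg_log_quotient x < neg_log_quotient y"
proof -
  have s: "(\<lambda>K. y ^ K / real (Suc K) - x ^ K / real (Suc K)) sums (neg_log_quotient y - neg_log_quotient x)"
    using assms by (intro sums_diff neg_log_quotient_sums) auto
  have "(\<Sum>K\<in>{1}. y ^ K / real (Suc K) - x ^ K / real (Suc K)) \<le> (\<Sum>K. y ^ K / real (Suc K) - x ^ K / real (Suc K))"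
    using assms by (intro sum_le_suminf sums_summable[OF s]) (auto intro!: divide_right_mono power_mono)
  then show ?thesis using sums_unique[OF s] assms by simp
qed

lemma neg_log_quotient_ge_1: "0 \<le> x \<Longrightarrow> x < 1 \<Longrightarrow> 1 \<le> neg_log_quotient x"
  using neg_log_quotient_strict_mono[of 0 x] by (cases "x = 0") (auto simp: neg_log_quotient_def[of 0])

lemma (in splitting_tree) expected_extinction_time:
  assumes "0 \<le> \<delta>" "\<delta> < 1" "AE r in life_law. 0 < r" "(\<integral>\<^sup>+r. ennreal r \<partial>life_law) = 1"
  shows "(\<integral>\<^sup>+\<omega>. extinction_time (\<lambda>u. life u \<omega>) (\<lambda>u i. wait u i \<omega>) \<partial>M) =
    ennreal (neg_log_quotient \<delta>)"
proof -
  have "(\<integral>\<^sup>+\<omega>. extinction_time (\<lambda>u. life u \<omega>) (\<lambda>u i. wait u i \<omega>) \<partial>M)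
    = (\<Sum>K. \<integral>\<^sup>+\<omega>. time_at (\<lambda>u. life u \<omega>) (\<lambda>u i. wait u i \<omega>) (Suc K) \<partial>M)"
    unfolding extinction_time_def by (intro nn_integral_suminf nn_integral_time_at(2) assms)
  also have "\<dots> = (\<Sum>K. ennreal (\<delta> ^ K / real (Suc K)))"
    using assms by (subst expected_time_at) auto
  also have "\<dots> = ennreal (neg_log_quotient \<delta>)"
    using assms neg_log_quotient_sums[of \<delta>] neg_log_quotient_ge_1[of \<delta>]
    by (intro sums_unique[symmetric], subst sums_ennreal) auto
  finally show ?thesis .
qed

text \<open>The closed form \<open>h\<close> may lie outside \<open>R\<close>; then no
  \<open>d\<close> is an estimator.\<close>

lemma moment_estimator_inverse:
  assumes "\<And>\<delta>. \<delta> \<in> R \<Longrightarrow> E \<delta> = ennreal (f \<delta>)" "\<And>\<delta>. \<delta> \<in> R \<Longrightarrow> 0 \<le> f \<delta>" "0 \<le> s"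
    and "\<And>\<delta>. \<delta> \<in> R \<Longrightarrow> f \<delta> = s \<longleftrightarrow> \<delta> = h"
  shows "moment_estimator E R s d \<longleftrightarrow> d \<in> R \<and> d = h"
  using assms by (auto simp: moment_estimator_def)

text \<open>Take logarithms and divide by \<open>d\<close>. The root 0 is present for every
  \<open>t\<close> and says nothing about the expectation, hence the restriction to
  \<open>0 < d\<close>.\<close>

lemma extinction_equation_iff:
  fixes d t :: real
  assumes "0 < d"
  shows "1 - d = exp (- d * t) \<longleftrightarrow> d < 1 \<and> neg_log_quotient d = t"
proof
  assume *: "1 - d = exp (- d * t)"
  then have "0 < 1 - d" by simp
  moreover have "ln (1 - d) = - d * t" unfolding * by simp
  ultimately show "d < 1 \<and> neg_log_quotient d = t" using assms by (simp add: neg_log_quotient_def)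
next
  assume "d < 1 \<and> neg_log_quotient d = t"
  then have "ln (1 - d) = - d * t" "0 < 1 - d" using assms by (auto simp: neg_log_quotient_def)
  then show "1 - d = exp (- d * t)" by (metis exp_ln)
qed

lemma neg_log_quotient_surj:
  assumes "1 < t"
  obtains x where "0 < x" "x < 1" "neg_log_quotient x = t"
proof -
  \<comment> \<open>Half of \<open>1 - 1 / t\<close> keeps \<open>1 - a\<close> above
    \<open>1 / t\<close>, so that \<open>- ln (1 - a) \<le> a / (1 - a) \<le> a * t\<close>: the
    quotient at \<open>a\<close> is at most \<open>t\<close>.\<close>
  define a where "a = (1 - 1 / t) / 2"
  \<comment> \<open>Here \<open>- ln (1 - b) = t\<close>, which is at least \<open>b * t\<close>
    because \<open>b < 1\<close>.\<close>
  define b where "b = 1 - exp (- t)"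
  have "t < exp t" using exp_ge_add_one_self[of t] by linarith
  then have "exp (- t) < 1 / t" using assms by (simp add: exp_minus field_simps)
  moreover have "0 < 1 - 1 / t" using assms by simp
  ultimately have ab: "0 < a" "a \<le> b" "b < 1" and ta: "1 < t * (1 - a)"
    using assms by (auto simp: a_def b_def field_simps)
  have "- ln (1 - a) \<le> a / (1 - a)"
    using ln_le_minus_one[of "1 / (1 - a)"] ab by (simp add: ln_div field_simps)
  also have "\<dots> \<le> a * t"
    using mult_left_mono[OF less_imp_le[OF ta], of a] ab by (simp add: pos_divide_le_eq mult.assoc)
  finally have a: "- ln (1 - a) - a * t \<le> 0" by simp
  have b: "0 \<le> - ln (1 - b) - b * t"
    using assms by (simp add: b_def algebra_simps)
  have "continuous_on {a..b} (\<lambda>x. - ln (1 - x) - x * t)"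
    using ab by (intro continuous_intros) auto
  from IVT'[OF a b ab(2) this] obtain x where "a \<le> x" "x \<le> b" "- ln (1 - x) - x * t = 0" by blast
  with ab show ?thesis by (intro that[of x]) (auto simp: neg_log_quotient_def field_simps)
qed

text \<open>The quotient increases strictly from 1 without bound, so for \<open>t > 1\<close> there
  is exactly one positive root, and it lies above the root 0; for \<open>t = 1\<close> the largest
  root is 0 itself. For \<open>t < 1\<close> no root is positive and 0 is still the largest,
  although no rate has mean \<open>t\<close>; the condition \<open>1 \<le> t\<close> excludes
  this.\<close>

lemma neg_log_quotient_eq_iff_largest_solution:
  fixes d t :: real
  shows "0 \<le> d \<and> d < 1 \<and> neg_log_quotient d = t \<longleftrightarrow>
    1 \<le> t \<and> largest_solution (\<lambda>\<delta>. 1 - \<delta> = exp (- \<delta> * t)) d"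
proof
  assume d: "0 \<le> d \<and> d < 1 \<and> neg_log_quotient d = t"
  have "d' \<le> d" if "1 - d' = exp (- d' * t)" for d'
    using that d extinction_equation_iff[of d' t] neg_log_quotient_strict_mono[of d d']
    by (cases "0 < d'") force+
  moreover have "1 - d = exp (- d * t)"
    using d extinction_equation_iff[of d t] by (cases "d = 0") auto
  ultimately show "1 \<le> t \<and> largest_solution (\<lambda>\<delta>. 1 - \<delta> = exp (- \<delta> * t)) d"
    using d neg_log_quotient_ge_1[of d] by (auto simp: largest_solution_def)
next
  assume *: "1 \<le> t \<and> largest_solution (\<lambda>\<delta>. 1 - \<delta> = exp (- \<delta> * t)) d"
  then have sol: "1 - d = exp (- d * t)" and max: "\<And>d'. 1 - d' = exp (- d' * t) \<Longrightarrow> d' \<le> d"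
    by (auto simp: largest_solution_def)
  have "0 \<le> d" using max[of 0] by simp
  show "0 \<le> d \<and> d < 1 \<and> neg_log_quotient d = t"
  proof (cases "d = 0")
    case True
    have "t = 1"
    proof (rule ccontr)
      assume "t \<noteq> 1"
      with * obtain x where "0 < x" "x < 1" "neg_log_quotient x = t"
        using neg_log_quotient_surj[of t] by auto
      with max[of x] extinction_equation_iff[of x t] True show False by simp
    qed
    with True show ?thesis by (simp add: neg_log_quotient_def)
  next
    case False
    with sol \<open>0 \<le> d\<close> extinction_equation_iff[of d t] show ?thesis by simp
  qed
qed

text \<open>Each equivalence also settles existence: the closed form lies in the range, or
  \<open>t \<ge> 1\<close> holds, exactly when the moment equation has a solution there.\<close>

theorem corollary1p2:
  fixes N :: "'n measure" and Q :: "'n \<Rightarrow> real"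
    and M :: "real \<Rightarrow> 'w measure"
    and life :: "real \<Rightarrow> individual \<Rightarrow> 'w \<Rightarrow> real"
    and wait :: "real \<Rightarrow> individual \<Rightarrow> nat \<Rightarrow> 'w \<Rightarrow> ennreal"
    and A :: "real \<Rightarrow> nat \<Rightarrow> 'w \<Rightarrow> ennreal"
    and T :: "real \<Rightarrow> 'w \<Rightarrow> ennreal"
  assumes "prob_space N"
    and "Q \<in> borel_measurable N"
    and "AE x in N. Q x > 0"
    and "integrable N Q" and "prob_space.expectation N Q = 1"
    and process: "\<And>\<delta>. \<delta> \<ge> 0 \<Longrightarrow>
          splitting_tree (M \<delta>) \<delta> (distr N borel Q) (life \<delta>) (wait \<delta>)"
    and A_eq: "\<And>\<delta> K \<omega>. A \<delta> K \<omega> = time_at (\<lambda>u. life \<delta> u \<omega>) (\<lambda>u i. wait \<delta> u i \<omega>) K"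
    and T_eq: "\<And>\<delta> \<omega>. T \<delta> \<omega> = extinction_time (\<lambda>u. life \<delta> u \<omega>) (\<lambda>u i. wait \<delta> u i \<omega>)"
  shows
    "(\<forall>(K::nat) (t::real) d. K \<ge> 2 \<and> t \<ge> 0 \<longrightarrow>
        (moment_estimator (\<lambda>\<delta>. \<integral>\<^sup>+\<omega>. A \<delta> K \<omega> \<partial>M \<delta>) {0..<1} t d \<longleftrightarrow>
           d \<in> {0..<1} \<and> d = (real K * t) powr (1 / (real K - 1))))
   \<and> (\<forall>(K::nat) (t::real) d. K \<ge> 2 \<and> t \<ge> 0 \<longrightarrow>
        (moment_estimator (\<lambda>\<delta>. \<integral>\<^sup>+\<omega>. A \<delta> K \<omega> \<partial>M \<delta>) {1<..} t d \<longleftrightarrow>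
           d \<in> {1<..} \<and> d = 1 / (real K * t)))
   \<and> (\<forall>(t::real) d. t \<ge> 0 \<longrightarrow>
        (moment_estimator (\<lambda>\<delta>. \<integral>\<^sup>+\<omega>. T \<delta> \<omega> \<partial>M \<delta>) {0..<1} t d \<longleftrightarrow>
           t \<ge> 1 \<and> largest_solution (\<lambda>\<delta>. 1 - \<delta> = exp (- \<delta> * t)) d))"
proof -
  note [measurable] = \<open>Q \<in> borel_measurable N\<close>
  have pos: "AE r in distr N borel Q. 0 < r"
    using \<open>AE x in N. Q x > 0\<close> by (simp add: AE_distr_iff)
  have mean: "(\<integral>\<^sup>+r. ennreal r \<partial>distr N borel Q) = 1"
  proof -
    have "(\<integral>\<^sup>+r. ennreal r \<partial>distr N borel Q) = (\<integral>\<^sup>+x. ennreal (Q x) \<partial>N)"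
      by (simp add: nn_integral_distr)
    also have "\<dots> = ennreal (integral\<^sup>L N Q)"
      using \<open>AE x in N. Q x > 0\<close> by (intro nn_integral_eq_integral \<open>integrable N Q\<close>) (auto intro: less_imp_le)
    finally show ?thesis using \<open>integral\<^sup>L N Q = 1\<close> by simp
  qed
  have EA: "(\<integral>\<^sup>+\<omega>. A \<delta> K \<omega> \<partial>M \<delta>) = ennreal (if \<delta> \<le> 1 then \<delta> ^ (K - 1) / real K else 1 / (\<delta> * real K))"
    if "0 \<le> \<delta>" "1 \<le> K" for \<delta> K
    unfolding A_eq using splitting_tree.expected_time_at[OF process[OF \<open>0 \<le> \<delta>\<close>] \<open>0 \<le> \<delta>\<close> pos mean \<open>1 \<le> K\<close>] .
  have ET: "(\<integral>\<^sup>+\<omega>. T \<delta> \<omega> \<partial>M \<delta>) = ennreal (neg_log_quotient \<delta>)" if "0 \<le> \<delta>" "\<delta> < 1" for \<delta>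
    unfolding T_eq using splitting_tree.expected_extinction_time[OF process[OF \<open>0 \<le> \<delta>\<close>] that pos mean] .
  show ?thesis
  proof (intro conjI allI impI)
    fix K :: nat and t d :: real
    assume "K \<ge> 2 \<and> t \<ge> 0"
    then have K: "2 \<le> K" and t: "0 \<le> t" by auto
    show "moment_estimator (\<lambda>\<delta>. \<integral>\<^sup>+\<omega>. A \<delta> K \<omega> \<partial>M \<delta>) {0..<1} t d \<longleftrightarrow>
        d \<in> {0..<1} \<and> d = (real K * t) powr (1 / (real K - 1))"
    proof (rule moment_estimator_inverse)
      fix \<delta> :: real assume \<delta>: "\<delta> \<in> {0..<1}"
      show "(\<integral>\<^sup>+\<omega>. A \<delta> K \<omega> \<partial>M \<delta>) = ennreal (\<delta> ^ (K - 1) / real K)"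
        using EA[of \<delta> K] \<delta> K by simp
      have "\<delta> ^ (K - 1) / real K = t \<longleftrightarrow> \<delta> ^ (K - 1) = real K * t"
        using K by (auto simp: field_simps)
      also have "\<dots> \<longleftrightarrow> \<delta> = (real K * t) powr (1 / (real K - 1))"
      proof -
        have n: "0 < K - 1" "real (K - 1) = real K - 1" using K by auto
        \<comment> \<open>The power form of the root needs a positive argument; at
          \<open>t = 0\<close> both sides are 0.\<close>
        have "root (K - 1) (real K * t) = (real K * t) powr (1 / (real K - 1))"
          using root_powr_inverse[of "K - 1" "real K * t"] n t K by (cases "t = 0") auto
        then show ?thesis
          using n \<delta> t real_root_pow_pos2[of "K - 1" "real K * t"] real_root_power_cancel[of "K - 1" \<delta>] by auto
      qed
      finally show "\<delta> ^ (K - 1) / real K = t \<longleftrightarrow> \<delta> = (real K * t) powr (1 / (real K - 1))" .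
    qed (use t in auto)
    show "moment_estimator (\<lambda>\<delta>. \<integral>\<^sup>+\<omega>. A \<delta> K \<omega> \<partial>M \<delta>) {1<..} t d \<longleftrightarrow>
        d \<in> {1<..} \<and> d = 1 / (real K * t)"
    proof (rule moment_estimator_inverse)
      fix \<delta> :: real assume \<delta>: "\<delta> \<in> {1<..}"
      show "(\<integral>\<^sup>+\<omega>. A \<delta> K \<omega> \<partial>M \<delta>) = ennreal (1 / (\<delta> * real K))"
        using EA[of \<delta> K] \<delta> K by simp
      \<comment> \<open>At \<open>t = 0\<close> the right side reads \<open>\<delta> = 0\<close> by
        the convention for division; both sides are then false for
        \<open>\<delta> > 1\<close>.\<close>
      show "1 / (\<delta> * real K) = t \<longleftrightarrow> \<delta> = 1 / (real K * t)"
        using \<delta> K by (cases "t = 0") (auto simp: field_simps)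
    qed (use t in auto)
  next
    fix t d :: real
    assume t: "t \<ge> 0"
    have "moment_estimator (\<lambda>\<delta>. \<integral>\<^sup>+\<omega>. T \<delta> \<omega> \<partial>M \<delta>) {0..<1} t d \<longleftrightarrow> 0 \<le> d \<and> d < 1 \<and> neg_log_quotient d = t"
    proof -
      have "neg_log_quotient x = neg_log_quotient y \<longleftrightarrow> x = y" if "x \<in> {0..<1}" "y \<in> {0..<1}" for x y
        using that neg_log_quotient_strict_mono[of x y] neg_log_quotient_strict_mono[of y x]
        by (cases x y rule: linorder_cases) auto
      moreover have "(\<integral>\<^sup>+\<omega>. T \<delta> \<omega> \<partial>M \<delta>) = ennreal t \<longleftrightarrow> neg_log_quotient \<delta> = t" if "\<delta> \<in> {0..<1}" for \<delta>
        using that ET[of \<delta>] neg_log_quotient_ge_1[of \<delta>] t by simp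
      ultimately show ?thesis by (auto simp: moment_estimator_def)
    qed
    then show "moment_estimator (\<lambda>\<delta>. \<integral>\<^sup>+\<omega>. T \<delta> \<omega> \<partial>M \<delta>) {0..<1} t d \<longleftrightarrow>
        t \<ge> 1 \<and> largest_solution (\<lambda>\<delta>. 1 - \<delta> = exp (- \<delta> * t)) d"
      by (simp only: neg_log_quotient_eq_iff_largest_solution)
  qed
qed

end
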